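(* Let $D,T$ be the unitary operators on $L^2(\mathbb{R})$ given by $(Tf)(t)=f(t-1)$ and $(Df)(t)=\sqrt{2}f(2t)$, let $\mathcal{F}$ be the Fourier–Plancherel transform on $L^2(\mathbb{R})$, and put $\widehat{D}=\mathcal{F}D\mathcal{F}^{-1}$, $\widehat{T}=\mathcal{F}T\mathcal{F}^{-1}$. Then the commutant of $\{\widehat D,\widehat T\}$ is $$\{\widehat D,\widehat T\}'=\{M_h : h\in L^\infty(\mathbb{R}) \text{ and } h(s)=h(2s) \text{ for a.e. } s\in\mathbb{R}\},$$ where $M_h$ denotes the multiplication operator $f\mapsto hf$.
   Context: The Fourier–Plancherel transform is normalized so that for $f\in L^1(\mathbb{R})\cap L^2(\mathbb{R})$, $(\mathcal{F}f)(s)=\frac{1}{\sqrt{2\pi}}\int_{\mathbb{R}}e^{-ist}f(t)\,dt$, extended to a unitary on $L^2(\mathbb{R})$ (Lebesgue measure). The commutant $\mathcal{S}'$ of a set $\mathcal{S}$ of bounded operators is the set of bounded operators commuting with every element of $\mathcal{S}$. *)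

theory Defs
  imports "HOL-Analysis.Analysis"
begin

text \<open>Elements of L2(R) are represented by square-integrable Borel functions
  real => complex; everything is understood modulo equality a.e.\<close>

definition L2 :: "(real \<Rightarrow> complex) \<Rightarrow> bool" where
  "L2 f \<longleftrightarrow> f \<in> borel_measurable lborel \<and> integrable lborel (\<lambda>t. (cmod (f t))\<^sup>2)"

definition Linf :: "(real \<Rightarrow> complex) \<Rightarrow> bool" where
  "Linf h \<longleftrightarrow> h \<in> borel_measurable lborel \<and> (\<exists>C. AE s in lborel. cmod (h s) \<le> C)"

definition ae_eq :: "(real \<Rightarrow> complex) \<Rightarrow> (real \<Rightarrow> complex) \<Rightarrow> bool" where
  "ae_eq f g \<longleftrightarrow> (AE t in lborel. f t = g t)"

definition L2_norm :: "(real \<Rightarrow> complex) \<Rightarrow> real" where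
  "L2_norm f = sqrt (LINT t|lborel. (cmod (f t))\<^sup>2)"

definition fourier_integral :: "(real \<Rightarrow> complex) \<Rightarrow> real \<Rightarrow> complex" where
  "fourier_integral f s =
     (LINT t|lborel. exp (- \<i> * complex_of_real (s * t)) * f t) / complex_of_real (sqrt (2 * pi))"

text \<open>Fourier--Plancherel transform: the L2-limit of the Fourier integrals of the
  truncations f * indicator [-n,n] (these lie in L1 and L2); this is the unitary extension
  of the Fourier integral from L1 \<inter> L2.\<close>
definition FP :: "(real \<Rightarrow> complex) \<Rightarrow> (real \<Rightarrow> complex)" where
  "FP f = (SOME g. L2 g \<and>
     (\<lambda>n::nat. L2_norm (\<lambda>s. g s - fourier_integral
         (\<lambda>t. complex_of_real (indicator {- real n..real n} t) * f t) s)) \<longlonglongrightarrow> 0)"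

definition FP_inv :: "(real \<Rightarrow> complex) \<Rightarrow> (real \<Rightarrow> complex)" where
  "FP_inv g = (SOME f. L2 f \<and> ae_eq (FP f) g)"

definition transl :: "(real \<Rightarrow> complex) \<Rightarrow> (real \<Rightarrow> complex)" where
  "transl f = (\<lambda>t. f (t - 1))"

definition dil :: "(real \<Rightarrow> complex) \<Rightarrow> (real \<Rightarrow> complex)" where
  "dil f = (\<lambda>t. complex_of_real (sqrt 2) * f (2 * t))"

definition D_hat :: "(real \<Rightarrow> complex) \<Rightarrow> (real \<Rightarrow> complex)" where
  "D_hat g = FP (dil (FP_inv g))"

definition T_hat :: "(real \<Rightarrow> complex) \<Rightarrow> (real \<Rightarrow> complex)" where
  "T_hat g = FP (transl (FP_inv g))"

definition mult_op :: "(real \<Rightarrow> complex) \<Rightarrow> (real \<Rightarrow> complex) \<Rightarrow> (real \<Rightarrow> complex)" where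
  "mult_op h f = (\<lambda>s. h s * f s)"

definition bounded_op :: "((real \<Rightarrow> complex) \<Rightarrow> (real \<Rightarrow> complex)) \<Rightarrow> bool" where
  "bounded_op A \<longleftrightarrow>
     (\<forall>f. L2 f \<longrightarrow> L2 (A f)) \<and>
     (\<forall>f g. L2 f \<longrightarrow> L2 g \<longrightarrow> ae_eq f g \<longrightarrow> ae_eq (A f) (A g)) \<and>
     (\<forall>f g a. L2 f \<longrightarrow> L2 g \<longrightarrow> ae_eq (A (\<lambda>t. f t + a * g t)) (\<lambda>t. A f t + a * A g t)) \<and>
     (\<exists>C. \<forall>f. L2 f \<longrightarrow> L2_norm (A f) \<le> C * L2_norm f)"

definition commutes :: "((real \<Rightarrow> complex) \<Rightarrow> (real \<Rightarrow> complex)) \<Rightarrow>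
    ((real \<Rightarrow> complex) \<Rightarrow> (real \<Rightarrow> complex)) \<Rightarrow> bool" where
  "commutes A B \<longleftrightarrow> (\<forall>f. L2 f \<longrightarrow> ae_eq (A (B f)) (B (A f)))"

end

theory Submission
  imports Defs "HOL-Probability.Characteristic_Functions"
begin

text \<open>
  On L1 the Fourier integral satisfies \<open>\<integral> (F f) g = \<integral> f (F g)\<close>. Inserting a Gaussian weight turns
  \<open>\<integral> \<bar>F f\<bar>\<^sup>2\<close> into \<open>\<integral> f cnj (f * N)\<close> with a normal density \<open>N\<close>, which is at most \<open>\<integral> \<bar>f\<bar>\<^sup>2\<close> since
  \<open>2 a b \<le> a\<^sup>2 + b\<^sup>2\<close>; hence the Fourier integral is an L2 contraction and extends to \<open>FP\<close>. The same Gaussian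
  weight gives \<open>FP (FP f) s = f (- s)\<close>, so \<open>FP\<close> is surjective, and one reads off that
  \<open>T_hat\<close> is multiplication by \<open>e\<^sup>-\<^sup>i\<^sup>s\<close> and \<open>(D_hat g) s = g (s / 2) / sqrt 2\<close>.

  If \<open>A\<close> commutes with both, the bounded Borel functions \<open>\<phi>\<close> with \<open>A M\<^sub>\<phi> = M\<^sub>\<phi> A\<close> form an algebra closed
  under bounded pointwise limits, and conjugation by \<open>D_hat\<close> shows that it is closed under
  \<open>\<phi> \<mapsto> \<phi> (\<cdot> / 2)\<close>. So it contains \<open>p (2\<^sup>n sin (s / 2\<^sup>n))\<close> for every polynomial \<open>p\<close>, by Weierstrass
  \<open>g (2\<^sup>n sin (s / 2\<^sup>n))\<close> for every bounded continuous \<open>g\<close>, in the limit \<open>n \<rightarrow> \<infinity>\<close> every such \<open>g\<close>, and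
  finally every bounded Borel function. Testing on a Gaussian \<open>w\<close> yields \<open>A = M\<^sub>h\<close> with \<open>h = A w / w\<close>.
\<close>

section \<open>Mean square convergence\<close>

text \<open>Working with the \<open>ennreal\<close>-valued square of the norm avoids integrability side conditions; the
  triangle inequality is only needed up to a factor 2.\<close>

definition L2_sq :: "(real \<Rightarrow> complex) \<Rightarrow> ennreal" where
  "L2_sq f = (\<integral>\<^sup>+t. ennreal ((cmod (f t))\<^sup>2) \<partial>lborel)"

lemma L2_iff_L2_sq: "L2 f \<longleftrightarrow> f \<in> borel_measurable borel \<and> L2_sq f < \<infinity>"
  unfolding L2_def L2_sq_def integrable_iff_bounded by auto

lemma L2_measurable [measurable_dest]: "L2 f \<Longrightarrow> f \<in> borel_measurable borel"
  by (simp add: L2_iff_L2_sq)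

lemma L2_sq_eq_L2_norm: "L2 f \<Longrightarrow> L2_sq f = ennreal ((L2_norm f)\<^sup>2)"
  unfolding L2_def L2_sq_def L2_norm_def by (auto simp: nn_integral_eq_integral)

lemma L2_sq_mono_AE:
  assumes "AE t in lborel. cmod (f t) \<le> cmod (g t)"
  shows "L2_sq f \<le> L2_sq g"
  unfolding L2_sq_def
  by (intro nn_integral_mono_AE) (use assms in \<open>eventually_elim, auto intro!: ennreal_leI power_mono\<close>)

lemma L2_sq_mono: "(\<And>t. cmod (f t) \<le> cmod (g t)) \<Longrightarrow> L2_sq f \<le> L2_sq g"
  by (intro L2_sq_mono_AE) auto

lemma L2_sq_cong_AE: "AE t in lborel. cmod (f t) = cmod (g t) \<Longrightarrow> L2_sq f = L2_sq g"
  by (intro antisym L2_sq_mono_AE) auto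

lemma L2_sq_scale:
  assumes [measurable]: "f \<in> borel_measurable borel"
  shows "L2_sq (\<lambda>t. c * f t) = ennreal ((cmod c)\<^sup>2) * L2_sq f"
  unfolding L2_sq_def by (simp add: norm_mult power_mult_distrib ennreal_mult nn_integral_cmult)

lemma L2_sq_minus_commute: "L2_sq (\<lambda>t. f t - g t) = L2_sq (\<lambda>t. g t - f t)"
  unfolding L2_sq_def by (simp add: norm_minus_commute)

lemma L2_sq_add_le:
  assumes [measurable]: "f \<in> borel_measurable borel" "g \<in> borel_measurable borel"
  shows "L2_sq (\<lambda>t. f t + g t) \<le> 2 * L2_sq f + 2 * L2_sq g"
proof -
  have *: "(cmod (a + b))\<^sup>2 \<le> 2 * (cmod a)\<^sup>2 + 2 * (cmod b)\<^sup>2" for a b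
  proof -
    have "(cmod (a + b))\<^sup>2 \<le> (cmod a + cmod b)\<^sup>2"
      by (intro power_mono norm_triangle_ineq) auto
    also have "\<dots> \<le> 2 * (cmod a)\<^sup>2 + 2 * (cmod b)\<^sup>2"
      using zero_le_power2[of "cmod a - cmod b"] by (simp add: power2_eq_square algebra_simps)
    finally show ?thesis .
  qed
  have "L2_sq (\<lambda>t. f t + g t) \<le> (\<integral>\<^sup>+t. 2 * ennreal ((cmod (f t))\<^sup>2) + 2 * ennreal ((cmod (g t))\<^sup>2) \<partial>lborel)"
    unfolding L2_sq_def
  proof (rule nn_integral_mono)
    fix x
    have "2 * ennreal ((cmod (f x))\<^sup>2) + 2 * ennreal ((cmod (g x))\<^sup>2) = ennreal (2 * (cmod (f x))\<^sup>2 + 2 * (cmod (g x))\<^sup>2)"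
      by (simp add: ennreal_plus ennreal_mult)
    then show "ennreal ((cmod (f x + g x))\<^sup>2) \<le> 2 * ennreal ((cmod (f x))\<^sup>2) + 2 * ennreal ((cmod (g x))\<^sup>2)"
      using * by (simp add: ennreal_leI del: ennreal_plus)
  qed
  also have "\<dots> = 2 * L2_sq f + 2 * L2_sq g"
    unfolding L2_sq_def by (simp add: nn_integral_add nn_integral_cmult)
  finally show ?thesis .
qed

lemma L2_sq_triangle:
  assumes [measurable]: "f \<in> borel_measurable borel" "g \<in> borel_measurable borel" "h \<in> borel_measurable borel"
  shows "L2_sq (\<lambda>t. f t - h t) \<le> 2 * L2_sq (\<lambda>t. f t - g t) + 2 * L2_sq (\<lambda>t. g t - h t)"
  using L2_sq_add_le[of "\<lambda>t. f t - g t" "\<lambda>t. g t - h t"] by simp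

lemma L2_sq_eq_0_iff:
  assumes [measurable]: "f \<in> borel_measurable borel"
  shows "L2_sq f = 0 \<longleftrightarrow> (AE t in lborel. f t = 0)"
  unfolding L2_sq_def by (subst nn_integral_0_iff_AE) auto

lemma ae_eq_iff_L2_sq:
  assumes [measurable]: "f \<in> borel_measurable borel" "g \<in> borel_measurable borel"
  shows "ae_eq f g \<longleftrightarrow> L2_sq (\<lambda>t. f t - g t) = 0"
  unfolding ae_eq_def by (subst L2_sq_eq_0_iff) auto

text \<open>Lower semicontinuity under a.e. convergence. It is used to identify mean square limits
  with pointwise ones, to prove completeness, and to remove the Gaussian weight from the Fourier
  integral.\<close>

lemma L2_sq_fatou:
  assumes [measurable]: "\<And>n::nat. f n \<in> borel_measurable borel"
    and lim: "AE t in lborel. (\<lambda>n. f n t) \<longlonglongrightarrow> g t"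
  shows "L2_sq g \<le> liminf (\<lambda>n. L2_sq (f n))"
proof -
  have "L2_sq g = (\<integral>\<^sup>+t. liminf (\<lambda>n. ennreal ((cmod (f n t))\<^sup>2)) \<partial>lborel)"
    unfolding L2_sq_def
  proof (rule nn_integral_cong_AE)
    show "AE t in lborel. ennreal ((cmod (g t))\<^sup>2) = liminf (\<lambda>n. ennreal ((cmod (f n t))\<^sup>2))"
      using lim
    proof eventually_elim
      case (elim t)
      then have "(\<lambda>n. ennreal ((cmod (f n t))\<^sup>2)) \<longlonglongrightarrow> ennreal ((cmod (g t))\<^sup>2)"
        by (intro tendsto_ennrealI tendsto_intros)
      then show ?case using lim_imp_Liminf[OF sequentially_bot] by metis
    qed
  qed
  also have "\<dots> \<le> liminf (\<lambda>n. L2_sq (f n))"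
    unfolding L2_sq_def by (rule nn_integral_liminf) simp
  finally show ?thesis .
qed

lemma L2_sq_dominated:
  assumes [measurable]: "\<And>n::nat. f n \<in> borel_measurable borel" "g \<in> borel_measurable borel"
    and lim: "AE t in lborel. (\<lambda>n. f n t) \<longlonglongrightarrow> g t"
    and bd: "\<And>n. AE t in lborel. cmod (f n t) \<le> C * cmod (w t)"
    and w: "L2 w"
  shows "(\<lambda>n. L2_sq (\<lambda>t. f n t - g t)) \<longlonglongrightarrow> 0"
proof -
  have w' [measurable]: "w \<in> borel_measurable borel" using w by (rule L2_measurable)
  \<comment> \<open>The domination passes to the limit, so |f n - g| is at most 2 * C * |w|; this is
    where the constant in the dominating function comes from.\<close>
  have gb: "AE t in lborel. cmod (g t) \<le> C * cmod (w t)"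
    using lim bd[THEN AE_all_countable[THEN iffD2, OF allI]]
    by eventually_elim (rule LIMSEQ_le_const2[OF tendsto_norm], auto)
  have "(\<lambda>n. \<integral>\<^sup>+t. ennreal ((cmod (f n t - g t))\<^sup>2) \<partial>lborel) \<longlonglongrightarrow> (\<integral>\<^sup>+t. 0 \<partial>(lborel :: real measure))"
  proof (rule nn_integral_dominated_convergence[where w="\<lambda>t. ennreal ((2 * C)\<^sup>2 * (cmod (w t))\<^sup>2)"])
    show "AE t in lborel. ennreal ((cmod (f n t - g t))\<^sup>2) \<le> ennreal ((2 * C)\<^sup>2 * (cmod (w t))\<^sup>2)" for n
      using gb bd[of n]
    proof eventually_elim
      case (elim t)
      have "(cmod (f n t - g t))\<^sup>2 \<le> (2 * C * cmod (w t))\<^sup>2"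
        using elim norm_triangle_ineq4[of "f n t" "g t"] by (intro power_mono) auto
      then show ?case by (simp add: power_mult_distrib ennreal_leI)
    qed
    have "(\<integral>\<^sup>+t. ennreal ((2 * C)\<^sup>2 * (cmod (w t))\<^sup>2) \<partial>lborel) = ennreal ((2*C)\<^sup>2) * L2_sq w"
      unfolding L2_sq_def by (simp add: ennreal_mult nn_integral_cmult)
    also have "\<dots> < \<infinity>" using w by (simp add: L2_iff_L2_sq ennreal_mult_less_top)
    finally show "(\<integral>\<^sup>+t. ennreal ((2 * C)\<^sup>2 * (cmod (w t))\<^sup>2) \<partial>lborel) < \<infinity>" .
    show "AE t in lborel. (\<lambda>n. ennreal ((cmod (f n t - g t))\<^sup>2)) \<longlonglongrightarrow> 0"
      using lim
    proof eventually_elim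
      case (elim t)
      have "(\<lambda>n. ennreal ((cmod (f n t - g t))\<^sup>2)) \<longlonglongrightarrow> ennreal ((cmod (g t - g t))\<^sup>2)"
        using elim by (intro tendsto_ennrealI tendsto_intros)
      then show ?case by simp
    qed
  qed auto
  then show ?thesis by (simp add: L2_sq_def)
qed

lemma L2_add:
  assumes "L2 f" "L2 g" shows "L2 (\<lambda>t. f t + g t)"
proof -
  have [measurable]: "f \<in> borel_measurable borel" "g \<in> borel_measurable borel" using assms by (auto simp: L2_iff_L2_sq)
  have "2 * L2_sq f + 2 * L2_sq g < \<infinity>" using assms by (simp add: L2_iff_L2_sq ennreal_mult_less_top)
  with L2_sq_add_le[of f g] have "L2_sq (\<lambda>t. f t + g t) < \<infinity>" by (auto intro: le_less_trans)
  then show ?thesis by (simp add: L2_iff_L2_sq)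
qed

lemma L2_cmult: "L2 f \<Longrightarrow> L2 (\<lambda>t. c * f t)"
  by (auto simp: L2_iff_L2_sq L2_sq_scale ennreal_mult_less_top)

lemma L2_diff:
  assumes "L2 f" "L2 g" shows "L2 (\<lambda>t. f t - g t)"
  using L2_add[OF assms(1) L2_cmult[OF assms(2), of "-1"]] by simp

lemma L2_bounded_by:
  assumes "L2 w" "f \<in> borel_measurable borel" "AE t in lborel. cmod (f t) \<le> C * cmod (w t)"
  shows "L2 f"
proof -
  have "L2_sq f \<le> L2_sq (\<lambda>t. of_real C * w t)"
  proof (intro L2_sq_mono_AE)
    show "AE t in lborel. cmod (f t) \<le> cmod (of_real C * w t)"
      using assms(3)
    proof eventually_elim
      case (elim t)
      then show ?case using mult_right_mono[OF abs_ge_self[of C] norm_ge_zero[of "w t"]] by (simp add: norm_mult)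
    qed
  qed
  also have "\<dots> < \<infinity>" using L2_cmult[OF assms(1)] by (simp add: L2_iff_L2_sq)
  finally show ?thesis using assms(2) by (simp add: L2_iff_L2_sq)
qed

lemma L2_norm_tendsto_0_iff:
  assumes "\<And>n::nat. L2 (f n)"
  shows "(\<lambda>n. L2_norm (f n)) \<longlonglongrightarrow> 0 \<longleftrightarrow> (\<lambda>n. L2_sq (f n)) \<longlonglongrightarrow> 0"
proof -
  have "(\<lambda>n. L2_sq (f n)) \<longlonglongrightarrow> 0 \<longleftrightarrow> (\<lambda>n. (L2_norm (f n))\<^sup>2) \<longlonglongrightarrow> 0"
    by (simp add: L2_sq_eq_L2_norm[OF assms] ennreal_tendsto_0_iff)
  also have "\<dots> \<longleftrightarrow> (\<lambda>n. L2_norm (f n)) \<longlonglongrightarrow> 0"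
    by simp
  finally show ?thesis by simp
qed

lemma ennreal_limit_zeroI:
  assumes "\<And>n::nat. c \<le> (a::ennreal) * x n + b * y n" "x \<longlonglongrightarrow> 0" "y \<longlonglongrightarrow> 0" "a < \<infinity>" "b < \<infinity>"
  shows "c = 0"
proof -
  have "(\<lambda>n. a * x n + b * y n) \<longlonglongrightarrow> a * 0 + b * 0"
    using assms by (intro tendsto_add ennreal_tendsto_cmult) auto
  then have "c \<le> a * 0 + b * 0" by (rule LIMSEQ_le_const) (use assms in auto)
  then show ?thesis by simp
qed

lemma L2_sq_tendsto_unique_AE:
  assumes [measurable]: "\<And>n::nat. f n \<in> borel_measurable borel" "g \<in> borel_measurable borel" "h \<in> borel_measurable borel"
    and "(\<lambda>n. L2_sq (\<lambda>t. f n t - g t)) \<longlonglongrightarrow> 0" "(\<lambda>n. L2_sq (\<lambda>t. f n t - h t)) \<longlonglongrightarrow> 0"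
  shows "ae_eq g h"
proof -
  have "L2_sq (\<lambda>t. g t - h t) = 0"
  proof (rule ennreal_limit_zeroI)
    show "L2_sq (\<lambda>t. g t - h t) \<le> 2 * L2_sq (\<lambda>t. f n t - g t) + 2 * L2_sq (\<lambda>t. f n t - h t)" for n
      using L2_sq_triangle[of g "f n" h] by (simp add: L2_sq_minus_commute[of g])
  qed (use assms in auto)
  then show ?thesis by (simp add: ae_eq_iff_L2_sq)
qed

text \<open>Fatou applied to the differences \<open>f n - g\<close>: their a.e. limit
  \<open>h - g\<close> has squared norm at most the liminf of a null sequence.\<close>

lemma L2_sq_tendsto_pointwise_AE:
  assumes [measurable]: "\<And>n::nat. f n \<in> borel_measurable borel" "g \<in> borel_measurable borel" "h \<in> borel_measurable borel"
    and l: "(\<lambda>n. L2_sq (\<lambda>t. f n t - g t)) \<longlonglongrightarrow> 0" and p: "AE t in lborel. (\<lambda>n. f n t) \<longlonglongrightarrow> h t"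
  shows "ae_eq g h"
proof -
  have "L2_sq (\<lambda>t. h t - g t) \<le> liminf (\<lambda>n. L2_sq (\<lambda>t. f n t - g t))"
  proof (rule L2_sq_fatou)
    show "AE t in lborel. (\<lambda>n. f n t - g t) \<longlonglongrightarrow> h t - g t"
      using p by eventually_elim (intro tendsto_intros)
  qed simp
  also have "\<dots> = 0" using lim_imp_Liminf[OF sequentially_bot l] .
  finally show ?thesis using L2_sq_minus_commute[of h g] by (simp add: ae_eq_iff_L2_sq)
qed

lemma ennreal_le_suminf: "(f k :: ennreal) \<le> suminf f"
  using sum_le_suminf[of f "{k}"] by (simp add: summableI)

text \<open>Riesz-Fischer completeness: a subsequence with rapidly shrinking increments converges
  a.e., and Fatou shows that the whole sequence converges to that limit in mean square.\<close>

lemma L2_sq_cauchy_limit: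
  fixes g :: "nat \<Rightarrow> real \<Rightarrow> complex"
  assumes [measurable]: "\<And>n. g n \<in> borel_measurable borel"
    and cauchy: "\<And>e. e > 0 \<Longrightarrow> \<exists>N. \<forall>m\<ge>N. \<forall>n\<ge>N. L2_sq (\<lambda>t. g m t - g n t) \<le> ennreal e"
  shows "\<exists>h. h \<in> borel_measurable borel \<and> (\<lambda>n. L2_sq (\<lambda>t. h t - g n t)) \<longlonglongrightarrow> 0"
proof -
  have "\<exists>r. \<forall>k. (\<forall>m\<ge>r k. \<forall>n\<ge>r k. L2_sq (\<lambda>t. g m t - g n t) \<le> ennreal ((1/4)^k)) \<and> r k < r (Suc k)"
  proof (rule dependent_nat_choice)
    show "\<exists>x. \<forall>m\<ge>x. \<forall>n\<ge>x. L2_sq (\<lambda>t. g m t - g n t) \<le> ennreal ((1/4)^0)" using cauchy[of 1] by simp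
    fix x k
    obtain N where N: "\<forall>m\<ge>N. \<forall>n\<ge>N. L2_sq (\<lambda>t. g m t - g n t) \<le> ennreal ((1/4)^Suc k)"
      using cauchy[of "(1/4)^Suc k"] by auto
    show "\<exists>y. (\<forall>m\<ge>y. \<forall>n\<ge>y. L2_sq (\<lambda>t. g m t - g n t) \<le> ennreal ((1/4)^Suc k)) \<and> x < y"
      by (rule exI[of _ "max N (Suc x)"]) (use N in auto)
  qed
  then obtain r where r: "\<And>k m n. m \<ge> r k \<Longrightarrow> n \<ge> r k \<Longrightarrow> L2_sq (\<lambda>t. g m t - g n t) \<le> ennreal ((1/4)^k)"
    and rS: "\<And>k. r k < r (Suc k)" by blast
  \<comment> \<open>The squared norm of \<open>d k\<close> is at most 4^-k. Weighting by 2^k still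
    leaves a geometric series, and a finite weighted sum at t bounds each |d k t| by a geometric
    sequence with ratio sqrt (1/2).\<close>
  define d where "d k t = g (r (Suc k)) t - g (r k) t" for k t
  have d[measurable]: "d k \<in> borel_measurable borel" for k unfolding d_def by measurable
  have "(\<integral>\<^sup>+t. (\<Sum>k. ennreal (2^k * (cmod (d k t))\<^sup>2)) \<partial>lborel) = (\<Sum>k. ennreal (2^k) * L2_sq (d k))"
    unfolding L2_sq_def by (subst nn_integral_suminf) (auto simp: ennreal_mult nn_integral_cmult)
  also have "\<dots> \<le> (\<Sum>k. ennreal ((1/2)^k))"
  proof (intro suminf_le)
    fix k
    have "L2_sq (d k) \<le> ennreal ((1/4)^k)" unfolding d_def using rS[of k] by (intro r) auto
    then have "ennreal (2^k) * L2_sq (d k) \<le> ennreal (2^k) * ennreal ((1/4)^k)" by (intro mult_left_mono) auto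
    also have "\<dots> = ennreal ((1/2)^k)" 
    proof -
      have "(2::real)^k * (1/4)^k = (2 * (1/4))^k" by (rule power_mult_distrib[symmetric])
      also have "(2 * (1/4) :: real) = 1/2" by simp
      finally show ?thesis by (metis ennreal_mult zero_le_numeral zero_le_power zero_le_divide_1_iff)
    qed
    finally show "ennreal (2^k) * L2_sq (d k) \<le> ennreal ((1/2)^k)" .
  qed auto
  also have "\<dots> < \<infinity>" by (subst suminf_ennreal2) (auto intro!: summable_geometric)
  finally have "AE t in lborel. (\<Sum>k. ennreal (2^k * (cmod (d k t))\<^sup>2)) \<noteq> \<infinity>"
    by (intro nn_integral_noteq_infinite) auto
  then have conv: "AE t in lborel. convergent (\<lambda>k. g (r k) t)"
  proof eventually_elim
    case (elim t)
    define C where "C = enn2real (\<Sum>k. ennreal (2^k * (cmod (d k t))\<^sup>2))"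
    have b: "cmod (d k t) \<le> sqrt C * (sqrt (1/2))^k" for k
    proof -
      have "ennreal (2^k * (cmod (d k t))\<^sup>2) \<le> (\<Sum>k. ennreal (2^k * (cmod (d k t))\<^sup>2))"
        by (rule ennreal_le_suminf[where f="\<lambda>k. ennreal (2^k * (cmod (d k t))\<^sup>2)"])
      also have "\<dots> = ennreal C" unfolding C_def 
        by (rule ennreal_enn2real[symmetric]) (use elim in \<open>simp only: less_top infinity_ennreal_def\<close>)
      finally have "2^k * (cmod (d k t))\<^sup>2 \<le> C" by (subst (asm) ennreal_le_iff) (simp_all add: C_def)
      then have "(cmod (d k t))\<^sup>2 \<le> C * (1/2)^k"
        using mult_right_mono[of "2^k * (cmod (d k t))\<^sup>2" C "(1/2)^k"] by (simp add: power_one_over)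
      then have "cmod (d k t) \<le> sqrt (C * (1/2)^k)" by (simp add: real_le_rsqrt)
      then show ?thesis by (simp add: real_sqrt_mult real_sqrt_power)
    qed
    have "summable (\<lambda>k. sqrt C * (sqrt (1/2))^k)" by (intro summable_mult summable_geometric) (simp add: real_sqrt_divide)
    then have "summable (\<lambda>k. d k t)" by (rule summable_comparison_test') (use b in auto)
    then have "summable (\<lambda>k. g (r (Suc k)) t - g (r k) t)" unfolding d_def .
    then have "convergent (\<lambda>n. (\<Sum>k<n. g (r (Suc k)) t - g (r k) t) + g (r 0) t)"
      unfolding summable_iff_convergent by (intro convergent_add convergent_const)
    then show ?case using sum_lessThan_telescope[of "\<lambda>k. g (r k) t"] by simp
  qed
  \<comment> \<open>On the null set where the subsequence diverges, \<open>lim\<close> returns an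
    unspecified value, which a.e. statements do not see.\<close>
  define h where "h t = lim (\<lambda>k. g (r k) t)" for t
  have h[measurable]: "h \<in> borel_measurable borel" unfolding h_def by measurable
  have lim: "AE t in lborel. (\<lambda>k. g (r k) t) \<longlonglongrightarrow> h t"
    using conv unfolding h_def by eventually_elim (simp add: convergent_LIMSEQ_iff)
  have mono_r: "strict_mono r" using rS by (rule strict_mono_Suc_iff[THEN iffD2, rule_format])
  have "limsup (\<lambda>n. L2_sq (\<lambda>t. h t - g n t)) \<le> 0"
  proof -
    have lim_le: "limsup (\<lambda>n. L2_sq (\<lambda>t. h t - g n t)) \<le> ennreal e" if e: "e > 0" for e
    proof -
      obtain N where N: "\<forall>m\<ge>N. \<forall>n\<ge>N. L2_sq (\<lambda>t. g m t - g n t) \<le> ennreal e" using cauchy[OF e] by auto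
      have "L2_sq (\<lambda>t. h t - g n t) \<le> ennreal e" if "n \<ge> N" for n
      proof -
        \<comment> \<open>Here n is fixed and Fatou is applied along the subsequence; its indices
          eventually exceed N because r k >= k.\<close>
        have "L2_sq (\<lambda>t. h t - g n t) \<le> liminf (\<lambda>k. L2_sq (\<lambda>t. g (r k) t - g n t))"
        proof (rule L2_sq_fatou)
          show "AE t in lborel. (\<lambda>k. g (r k) t - g n t) \<longlonglongrightarrow> h t - g n t"
            using lim by eventually_elim (intro tendsto_intros)
        qed simp
        also have "\<dots> \<le> liminf (\<lambda>k::nat. ennreal e)"
        proof (rule Liminf_mono, rule eventually_sequentiallyI[of N])
          fix k assume "N \<le> k"
          then have "r k \<ge> N" using seq_suble[OF mono_r, of k] by auto
          then show "L2_sq (\<lambda>t. g (r k) t - g n t) \<le> ennreal e" using N that by auto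
        qed
        finally show ?thesis by (simp add: Liminf_const)
      qed
      then show ?thesis by (intro Limsup_bounded eventually_sequentiallyI[of N]) auto
    qed
    show "limsup (\<lambda>n. L2_sq (\<lambda>t. h t - g n t)) \<le> 0"
      by (rule ennreal_le_epsilon) (simp only: add_0 lim_le)
  qed
  then have "limsup (\<lambda>n. L2_sq (\<lambda>t. h t - g n t)) = 0" by (simp only: le_zero_eq)
  then have "(\<lambda>n. L2_sq (\<lambda>t. h t - g n t)) \<longlonglongrightarrow> 0" by (rule tendsto_0_if_Limsup_eq_0_ennreal)
  then show ?thesis using h by (intro exI[of _ h] conjI)
qed

section \<open>The Fourier integral\<close>

lemma norm_exp_i_real [simp]: "cmod (exp (- \<i> * complex_of_real x)) = 1" "cmod (exp (- (\<i> * complex_of_real x))) = 1"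
  using norm_exp_i_times[of "- x"] by simp_all

lemma integrable_exp_mult:
  assumes "integrable lborel f"
  shows "integrable lborel (\<lambda>t. exp (- \<i> * complex_of_real (s * t)) * f t)"
  using assms(1) by (rule Bochner_Integration.integrable_bound) (use assms in \<open>auto simp: norm_mult\<close>)

lemma fourier_integral_measurable [measurable]:
  assumes [measurable]: "f \<in> borel_measurable borel"
  shows "fourier_integral f \<in> borel_measurable borel"
  unfolding fourier_integral_def
  by (intro borel_measurable_divide borel_measurable_const lborel.borel_measurable_lebesgue_integral) measurable

text \<open>The factor 1 / sqrt (2 * pi) is at most 1 and is dropped; later steps use the bound only
  as some constant independent of s.\<close>

lemma fourier_integral_bound:
  assumes "integrable lborel f"
  shows "cmod (fourier_integral f s) \<le> (LINT t|lborel. cmod (f t))"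
proof -
  have "cmod (LINT t|lborel. exp (- \<i> * complex_of_real (s * t)) * f t) \<le> (LINT t|lborel. cmod (f t))"
    using integral_norm_bound[of lborel "\<lambda>t. exp (- \<i> * complex_of_real (s * t)) * f t"] by (simp add: norm_mult)
  moreover have "1 \<le> sqrt (2 * pi)" using pi_gt3 by simp
  moreover have "0 \<le> (LINT t|lborel. cmod (f t))" by simp
  ultimately have "cmod (LINT t|lborel. exp (- \<i> * complex_of_real (s * t)) * f t) / sqrt (2 * pi) \<le> (LINT t|lborel. cmod (f t)) / 1"
    by (intro frac_le) auto
  then show ?thesis unfolding fourier_integral_def by (simp add: norm_divide)
qed

lemma fourier_integral_add:
  assumes "integrable lborel f" "integrable lborel g"
  shows "fourier_integral (\<lambda>t. f t + c * g t) s = fourier_integral f s + c * fourier_integral g s"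
proof -
  have "(LINT t|lborel. exp (- \<i> * complex_of_real (s * t)) * (f t + c * g t)) =
    (LINT t|lborel. exp (- \<i> * complex_of_real (s * t)) * f t + c * (exp (- \<i> * complex_of_real (s * t)) * g t))"
    by (simp add: algebra_simps)
  also have "\<dots> = (LINT t|lborel. exp (- \<i> * complex_of_real (s * t)) * f t) + c * (LINT t|lborel. exp (- \<i> * complex_of_real (s * t)) * g t)"
    by (subst Bochner_Integration.integral_add)
       (use assms[THEN integrable_exp_mult] in \<open>auto simp del: of_real_mult\<close>)
  finally show ?thesis unfolding fourier_integral_def by (simp add: add_divide_distrib)
qed

lemma fourier_integral_diff:
  assumes "integrable lborel f" "integrable lborel g"
  shows "fourier_integral (\<lambda>t. f t - g t) s = fourier_integral f s - fourier_integral g s"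
  using fourier_integral_add[OF assms, of "-1"] by simp

lemma integrable_prod_mult:
  fixes f g :: "real \<Rightarrow> complex"
  assumes f: "integrable lborel f" and g: "integrable lborel g"
  shows "integrable (lborel \<Otimes>\<^sub>M lborel) (\<lambda>(x, y). f x * g y)"
proof (rule lborel_pair.Fubini_integrable)
  have [measurable]: "f \<in> borel_measurable borel" "g \<in> borel_measurable borel" using assms by auto
  show "(\<lambda>(x, y). f x * g y) \<in> borel_measurable (lborel \<Otimes>\<^sub>M lborel)" by measurable
  show "integrable lborel (\<lambda>x. LINT y|lborel. norm (case (x, y) of (x, y) \<Rightarrow> f x * g y))"
    using f by (simp add: norm_mult)
  show "AE x in lborel. integrable lborel (\<lambda>y. case (x, y) of (x, y) \<Rightarrow> f x * g y)"
    using g by simp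
qed

text \<open>Fubini for exp (-ist) f(t) g(s): the exponential is symmetric in s and t and has modulus
  1, so the product of the two integrable functions dominates.\<close>

lemma fourier_integral_multiplication_formula:
  assumes f: "integrable lborel f" and g: "integrable lborel g"
  shows "(LINT s|lborel. fourier_integral f s * g s) = (LINT t|lborel. f t * fourier_integral g t)"
proof -
  have [measurable]: "f \<in> borel_measurable borel" "g \<in> borel_measurable borel" using assms by auto
  let ?k = "\<lambda>t s. exp (- \<i> * complex_of_real (s * t)) * (f t * g s)"
  have "integrable (lborel \<Otimes>\<^sub>M lborel) (case_prod ?k)"
    using integrable_prod_mult[OF f g]
    by (rule Bochner_Integration.integrable_bound) (auto simp: norm_mult split_beta)
  then have "(LINT s|lborel. LINT t|lborel. ?k t s) = (LINT t|lborel. LINT s|lborel. ?k t s)"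
    by (rule lborel_pair.Fubini_integral)
  moreover have "(LINT t|lborel. ?k t s) = sqrt (2 * pi) * (fourier_integral f s * g s)" for s
  proof -
    have "(LINT t|lborel. ?k t s) = (LINT t|lborel. (exp (- \<i> * complex_of_real (s * t)) * f t) * g s)"
      by (simp add: mult.assoc)
    also have "\<dots> = (LINT t|lborel. exp (- \<i> * complex_of_real (s * t)) * f t) * g s" by (rule integral_mult_left_zero)
    finally show ?thesis by (simp add: fourier_integral_def)
  qed
  moreover have "(LINT s|lborel. ?k t s) = sqrt (2 * pi) * (f t * fourier_integral g t)" for t
  proof -
    have "(LINT s|lborel. ?k t s) = (LINT s|lborel. f t * (exp (- \<i> * complex_of_real (t * s)) * g s))"
      by (simp add: mult_ac)
    also have "\<dots> = f t * (LINT s|lborel. exp (- \<i> * complex_of_real (t * s)) * g s)" by (rule integral_mult_right_zero)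
    finally show ?thesis by (simp add: fourier_integral_def)
  qed
  ultimately show ?thesis by simp
qed

section \<open>Gaussian regularization and the L2 contraction property\<close>

definition gauss_weight :: "real \<Rightarrow> real \<Rightarrow> real" where
  "gauss_weight k s = exp (- (s / k)\<^sup>2 / 2)"

text \<open>For k > 0 this is the density of the centered normal law with standard deviation 1/k, an
  approximate identity as k grows, while \<open>gauss_weight k\<close> tends to 1 pointwise. The two
  are Fourier partners up to the factor sqrt (2 * pi).\<close>

definition gauss_kernel :: "real \<Rightarrow> real \<Rightarrow> real" where
  "gauss_kernel k x = k * std_normal_density (k * x)"

lemma gauss_measurable [measurable]:
  "gauss_weight k \<in> borel_measurable borel" "gauss_kernel k \<in> borel_measurable borel"
  unfolding gauss_weight_def gauss_kernel_def by measurable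

lemma gauss_weight_eq: "gauss_weight k s = sqrt (2 * pi) * std_normal_density (s / k)"
  by (simp add: gauss_weight_def std_normal_density_def)

lemma gauss_weight_bounds: "0 \<le> gauss_weight k s" "gauss_weight k s \<le> 1"
  by (auto simp: gauss_weight_def)

lemma gauss_kernel_nonneg: "k > 0 \<Longrightarrow> 0 \<le> gauss_kernel k x"
  by (simp add: gauss_kernel_def)

lemma integrable_gauss_weight: "k > 0 \<Longrightarrow> integrable lborel (gauss_weight k)"
  unfolding gauss_weight_eq[abs_def]
  using lborel_integrable_real_affine[of std_normal_density "1/k" 0] by simp

text \<open>The sign c is left free so that the kernel at u - t can be integrated over either
  variable.\<close>

lemma nn_integral_gauss_kernel:
  assumes k: "k > 0" and c: "\<bar>c\<bar> = 1"
  shows "(\<integral>\<^sup>+x. ennreal (gauss_kernel k (a + c * x)) \<partial>lborel) = 1"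
proof -
  have "(\<integral>\<^sup>+x. ennreal (std_normal_density x) \<partial>lborel) = 1"
    by (subst nn_integral_eq_integral) (auto simp: normal_density_nonneg)
  also have "(\<integral>\<^sup>+x. ennreal (std_normal_density x) \<partial>lborel)
      = \<bar>k * c\<bar> * (\<integral>\<^sup>+x. ennreal (std_normal_density (k * a + (k * c) * x)) \<partial>lborel)"
    using k c by (intro nn_integral_real_affine) auto
  also have "\<dots> = (\<integral>\<^sup>+x. ennreal (gauss_kernel k (a + c * x)) \<partial>lborel)"
    using k c
    by (subst nn_integral_cmult[symmetric]) (auto simp: gauss_kernel_def ennreal_mult' abs_mult algebra_simps)
  finally show ?thesis by simp
qed

text \<open>Rescaling by k reduces the integral to the characteristic function of the standard
  normal law. The modulation adds u to the frequency t, so the kernel is centered at t = -u; this is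
  the origin of the reflection in \<open>FP_FP\<close>.\<close>

lemma fourier_integral_gauss:
  assumes k: "k > 0"
  shows "fourier_integral (\<lambda>s. exp (- \<i> * complex_of_real (u * s)) * complex_of_real (gauss_weight k s)) t
    = complex_of_real (sqrt (2 * pi) * gauss_kernel k (t + u))"
proof -
  have c: "(LINT x|lborel. std_normal_density x *\<^sub>R iexp (y * x)) = complex_of_real (exp (- (y^2) / 2))" for y
    using fun_cong[OF char_std_normal_distribution, of y] unfolding char_def
    by (subst (asm) integral_density) (auto simp: normal_density_nonneg)
  have "(LINT s|lborel. exp (- \<i> * complex_of_real (t * s)) * (exp (- \<i> * complex_of_real (u * s)) * complex_of_real (gauss_weight k s)))
      = (LINT s|lborel. sqrt (2 * pi) * (std_normal_density (s / k) *\<^sub>R iexp ((- (t + u)) * s)))"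
  proof (intro Bochner_Integration.integral_cong refl)
    fix s
    have "exp (- \<i> * complex_of_real (t * s)) * exp (- \<i> * complex_of_real (u * s)) = iexp ((- (t + u)) * s)"
      by (subst exp_add[symmetric]) (simp add: ring_distribs)
    then have "exp (- \<i> * complex_of_real (t * s)) * (exp (- \<i> * complex_of_real (u * s)) * complex_of_real (gauss_weight k s))
      = iexp ((- (t + u)) * s) * complex_of_real (gauss_weight k s)"
      by (simp only: mult.assoc[symmetric])
    then show "exp (- \<i> * complex_of_real (t * s)) * (exp (- \<i> * complex_of_real (u * s)) * complex_of_real (gauss_weight k s))
      = sqrt (2 * pi) * (std_normal_density (s / k) *\<^sub>R iexp ((- (t + u)) * s))"
      by (simp add: gauss_weight_eq scaleR_conv_of_real mult_ac)
  qed
  also have "\<dots> = sqrt (2 * pi) * (LINT s|lborel. (std_normal_density (s / k) *\<^sub>R iexp ((- (t + u)) * s)))"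
    by (rule integral_mult_right_zero)
  also have "(LINT s|lborel. (std_normal_density (s / k) *\<^sub>R iexp ((- (t + u)) * s)))
      = \<bar>k\<bar> *\<^sub>R (LINT s|lborel. (std_normal_density ((0 + k * s) / k) *\<^sub>R iexp ((- (t + u)) * (0 + k * s))))"
    using k by (intro lborel_integral_real_affine) auto
  also have "(LINT s|lborel. (std_normal_density ((0 + k * s) / k) *\<^sub>R iexp ((- (t + u)) * (0 + k * s))))
    = (LINT s|lborel. std_normal_density s *\<^sub>R iexp ((- (t + u) * k) * s))"
    using k by (simp add: mult_ac)
  also have "\<dots> = complex_of_real (exp (- ((- (t + u) * k)^2) / 2))" by (rule c)
  finally have "fourier_integral (\<lambda>s. exp (- \<i> * complex_of_real (u * s)) * complex_of_real (gauss_weight k s)) t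
    = \<bar>k\<bar> *\<^sub>R complex_of_real (exp (- ((- (t + u) * k)^2) / 2))"
    unfolding fourier_integral_def by (simp add: scaleR_conv_of_real)
  also have "\<dots> = complex_of_real (sqrt (2 * pi) * gauss_kernel k (t + u))"
    using k power2_minus[of "t + u"]
    by (simp add: gauss_kernel_def std_normal_density_def scaleR_conv_of_real mult_ac power_mult_distrib)
  finally show ?thesis .
qed

lemma integrable_gauss_weight_mult:
  assumes k: "k > 0" and [measurable]: "g \<in> borel_measurable borel" and b: "\<And>s. cmod (g s) \<le> C"
  shows "integrable lborel (\<lambda>s. complex_of_real (gauss_weight k s) * g s)"
proof (rule Bochner_Integration.integrable_bound)
  show "integrable lborel (\<lambda>s. C * gauss_weight k s)" using integrable_gauss_weight[OF k] by simp
  have C: "0 \<le> C" using b[of 0] norm_ge_zero order_trans by blast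
  show "AE x in lborel. norm (complex_of_real (gauss_weight k x) * g x) \<le> norm (C * gauss_weight k x)"
    using b C by (intro always_eventually allI)
      (simp add: norm_mult gauss_weight_bounds mult.commute[of _ "cmod _"] mult_right_mono)
qed auto

text \<open>The multiplication formula with the modulated weight as second factor. The result is a
  Gaussian average of \<open>f\<close> around -u, from which the inversion formula will follow as k
  grows.\<close>

lemma fourier_integral_gauss_inversion:
  assumes k: "k > 0" and f: "integrable lborel f"
  shows "fourier_integral (\<lambda>s. complex_of_real (gauss_weight k s) * fourier_integral f s) u
     = (LINT t|lborel. f t * complex_of_real (gauss_kernel k (t + u)))"
proof -
  define g where "g = (\<lambda>s. exp (- \<i> * complex_of_real (u * s)) * complex_of_real (gauss_weight k s))"
  have g: "integrable lborel g"
    unfolding g_def using integrable_gauss_weight[OF k] by (intro integrable_exp_mult) simp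
  have "fourier_integral (\<lambda>s. complex_of_real (gauss_weight k s) * fourier_integral f s) u
     = (LINT s|lborel. fourier_integral f s * g s) / sqrt (2 * pi)"
    unfolding fourier_integral_def[of _ u] g_def by (simp add: mult_ac)
  also have "\<dots> = (LINT t|lborel. f t * fourier_integral g t) / sqrt (2 * pi)"
    by (simp only: fourier_integral_multiplication_formula[OF f g])
  also have "\<dots> = (LINT t|lborel. sqrt (2 * pi) * (f t * complex_of_real (gauss_kernel k (t + u)))) / sqrt (2 * pi)"
    unfolding g_def fourier_integral_gauss[OF k] by (simp add: mult_ac)
  also have "\<dots> = (LINT t|lborel. f t * complex_of_real (gauss_kernel k (t + u)))"
    by (subst integral_mult_right_zero) simp
  finally show ?thesis .
qed

lemma fourier_integral_cnj: "fourier_integral (\<lambda>t. cnj (f t)) s = cnj (fourier_integral f (- s))"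
proof -
  have "cnj (LINT t|lborel. exp (- \<i> * complex_of_real (- s * t)) * f t)
    = (LINT t|lborel. exp (- \<i> * complex_of_real (s * t)) * cnj (f t))"
  proof -
    have "(\<lambda>t. exp (- \<i> * complex_of_real (s * t)) * cnj (f t)) = (\<lambda>t. cnj (exp (- \<i> * complex_of_real (- s * t)) * f t))"
      by (simp add: exp_cnj)
    then show ?thesis by (simp only: Bochner_Integration.integral_cnj)
  qed
  then show ?thesis unfolding fourier_integral_def by simp
qed

lemma borel_measurable_cnj [measurable (raw)]:
  "f \<in> borel_measurable M \<Longrightarrow> (\<lambda>x. cnj (f x)) \<in> borel_measurable M"
  by (rule measurable_compose[OF _ borel_measurable_continuous_onI]) (auto intro: continuous_intros)

text \<open>With the weight present the integral is finite, and the multiplication formula moves the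
  transform from \<open>f\<close> onto \<open>g\<close>, whose transform is the conjugate of a
  Gaussian average of \<open>f\<close>. The resulting double integral of |f t| |f u| against the
  kernel is bounded as in the Schur test.\<close>

lemma L2_sq_gauss_fourier_le:
  assumes k: "k > 0" and f: "integrable lborel f"
  shows "(\<integral>\<^sup>+s. ennreal (gauss_weight k s * (cmod (fourier_integral f s))\<^sup>2) \<partial>lborel) \<le> L2_sq f"
proof -
  have [measurable]: "f \<in> borel_measurable borel" using f by auto
  let ?F = "fourier_integral f"
  let ?N = "\<lambda>t u. gauss_kernel k (u - t)"
  define g where "g = (\<lambda>s. complex_of_real (gauss_weight k s) * cnj (?F s))"
  have g: "integrable lborel g"
    unfolding g_def by (rule integrable_gauss_weight_mult[OF k]) (use fourier_integral_bound[OF f] in auto)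
  have gF: "complex_of_real (gauss_weight k s * (cmod (?F s))\<^sup>2) = ?F s * g s" for s
    unfolding g_def by (simp only: of_real_mult complex_norm_square mult_ac)
  have "integrable lborel (\<lambda>s. complex_of_real (gauss_weight k s) * (?F s * cnj (?F s)))"
    by (rule integrable_gauss_weight_mult[OF k, where C="(LINT t|lborel. cmod (f t)) * (LINT t|lborel. cmod (f t))"])
       (use fourier_integral_bound[OF f] in \<open>auto simp: norm_mult intro!: mult_mono\<close>)
  then have "integrable lborel (\<lambda>s. Re (complex_of_real (gauss_weight k s) * (?F s * cnj (?F s))))"
    by (rule integrable_Re)
  then have i1: "integrable lborel (\<lambda>s. gauss_weight k s * (cmod (?F s))\<^sup>2)"
    by (simp only: complex_norm_square[symmetric] of_real_mult[symmetric] Re_complex_of_real)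
  have Fg: "fourier_integral g t = cnj (LINT u|lborel. f u * complex_of_real (?N t u))" for t
    using fourier_integral_cnj[of "\<lambda>s. complex_of_real (gauss_weight k s) * ?F s" t]
    by (simp add: g_def fourier_integral_gauss_inversion[OF k f])
  \<comment> \<open>Unit mass in each variable separately; splitting by 2ab <= a^2 + b^2 produces
    two terms, and each of them uses one of these identities.\<close>
  have iN: "(\<integral>\<^sup>+u. ennreal (?N t u) \<partial>lborel) = 1" "(\<integral>\<^sup>+u. ennreal (?N u t) \<partial>lborel) = 1" for t
    using nn_integral_gauss_kernel[OF k, of 1 "-t"] nn_integral_gauss_kernel[OF k, of "-1" t] by (simp_all add: add.commute)
  have N0: "0 \<le> ?N t u" for t u using gauss_kernel_nonneg[OF k] .
  have "(\<integral>\<^sup>+s. ennreal (gauss_weight k s * (cmod (?F s))\<^sup>2) \<partial>lborel)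
     = ennreal (LINT s|lborel. gauss_weight k s * (cmod (?F s))\<^sup>2)"
    by (rule nn_integral_eq_integral[OF i1]) (auto simp: gauss_weight_bounds)
  also have "(LINT s|lborel. gauss_weight k s * (cmod (?F s))\<^sup>2) \<le> cmod (LINT s|lborel. complex_of_real (gauss_weight k s * (cmod (?F s))\<^sup>2))"
    by (simp only: integral_complex_of_real norm_of_real abs_ge_self)
  also have "(LINT s|lborel. complex_of_real (gauss_weight k s * (cmod (?F s))\<^sup>2)) = (LINT t|lborel. f t * fourier_integral g t)"
    by (simp only: gF fourier_integral_multiplication_formula[OF f g])
  also have "ennreal (cmod (LINT t|lborel. f t * fourier_integral g t)) \<le> (\<integral>\<^sup>+t. ennreal (cmod (f t * fourier_integral g t)) \<partial>lborel)"
  proof (rule integral_norm_bound_ennreal)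
    show "integrable lborel (\<lambda>t. f t * fourier_integral g t)"
    proof (rule Bochner_Integration.integrable_bound)
      show "integrable lborel (\<lambda>t. f t * complex_of_real (LINT t|lborel. cmod (g t)))" using f by simp
      have [measurable]: "g \<in> borel_measurable borel" using g by auto
      show "(\<lambda>t. f t * fourier_integral g t) \<in> borel_measurable lborel" by simp
      show "AE x in lborel. norm (f x * fourier_integral g x) \<le> norm (f x * complex_of_real (LINT t|lborel. cmod (g t)))"
        using fourier_integral_bound[OF g] by (auto simp: norm_mult intro!: mult_left_mono always_eventually)
    qed
  qed
  also have "\<dots> \<le> (\<integral>\<^sup>+t. (\<integral>\<^sup>+u. ennreal (cmod (f t) * cmod (f u) * ?N t u) \<partial>lborel) \<partial>lborel)"
  proof (rule nn_integral_mono)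
    fix t
    \<comment> \<open>If the integrand fails to be integrable, its Bochner integral is 0 by
      convention and the bound is trivial.\<close>
    have "ennreal (cmod (LINT u|lborel. f u * complex_of_real (?N t u))) \<le> (\<integral>\<^sup>+u. ennreal (cmod (f u * complex_of_real (?N t u))) \<partial>lborel)"
      by (cases "integrable lborel (\<lambda>u. f u * complex_of_real (?N t u))")
         (auto simp: integral_norm_bound_ennreal not_integrable_integral_eq)
    then have "ennreal (cmod (f t)) * ennreal (cmod (fourier_integral g t))
       \<le> ennreal (cmod (f t)) * (\<integral>\<^sup>+u. ennreal (cmod (f u * complex_of_real (?N t u))) \<partial>lborel)"
      unfolding Fg complex_mod_cnj by (rule mult_left_mono) simp
    also have "\<dots> = (\<integral>\<^sup>+u. ennreal (cmod (f t) * cmod (f u) * ?N t u) \<partial>lborel)"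
      by (subst nn_integral_cmult[symmetric])
         (auto simp: norm_mult N0 ennreal_mult[symmetric] mult.assoc)
    finally show "ennreal (cmod (f t * fourier_integral g t)) \<le> (\<integral>\<^sup>+u. ennreal (cmod (f t) * cmod (f u) * ?N t u) \<partial>lborel)"
      by (simp add: norm_mult ennreal_mult)
  qed
  also have "\<dots> \<le> (\<integral>\<^sup>+t. (\<integral>\<^sup>+u. ennreal (1/2) * (ennreal ((cmod (f t))\<^sup>2) * ennreal (?N t u)) + ennreal (1/2) * (ennreal ((cmod (f u))\<^sup>2) * ennreal (?N t u)) \<partial>lborel) \<partial>lborel)"
  proof (intro nn_integral_mono)
    fix t u
    have "cmod (f t) * cmod (f u) \<le> 1/2 * (cmod (f t))\<^sup>2 + 1/2 * (cmod (f u))\<^sup>2"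
      using zero_le_power2[of "cmod (f t) - cmod (f u)"] by (simp add: power2_eq_square algebra_simps)
    then have "cmod (f t) * cmod (f u) * ?N t u \<le> (1/2 * (cmod (f t))\<^sup>2 + 1/2 * (cmod (f u))\<^sup>2) * ?N t u"
      by (intro mult_right_mono N0)
    then have "ennreal (cmod (f t) * cmod (f u) * ?N t u) \<le> ennreal (1/2 * ((cmod (f t))\<^sup>2 * ?N t u) + 1/2 * ((cmod (f u))\<^sup>2 * ?N t u))"
      by (intro ennreal_leI) (simp add: algebra_simps)
    also have "\<dots> = ennreal (1/2) * (ennreal ((cmod (f t))\<^sup>2) * ennreal (?N t u)) + ennreal (1/2) * (ennreal ((cmod (f u))\<^sup>2) * ennreal (?N t u))"
    proof -
      have "ennreal (1/2 * (x * y)) = ennreal (1/2) * (ennreal x * ennreal y)" if "0 \<le> x" "0 \<le> y" for x y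
        using that by (subst ennreal_mult) (simp_all add: ennreal_mult)
      then show ?thesis by (subst ennreal_plus) (simp_all only: N0 zero_le_power2, simp_all add: N0)
    qed
    finally show "ennreal (cmod (f t) * cmod (f u) * ?N t u) \<le> ennreal (1/2) * (ennreal ((cmod (f t))\<^sup>2) * ennreal (?N t u)) + ennreal (1/2) * (ennreal ((cmod (f u))\<^sup>2) * ennreal (?N t u))" .
  qed
  also have "\<dots> = ennreal (1/2) * (\<integral>\<^sup>+t. (\<integral>\<^sup>+u. ennreal ((cmod (f t))\<^sup>2) * ennreal (?N t u) \<partial>lborel) \<partial>lborel)
      + ennreal (1/2) * (\<integral>\<^sup>+t. (\<integral>\<^sup>+u. ennreal ((cmod (f u))\<^sup>2) * ennreal (?N t u) \<partial>lborel) \<partial>lborel)"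
    by (subst nn_integral_add, simp, simp)+
       (subst nn_integral_add nn_integral_cmult, simp+)+
  also have "(\<integral>\<^sup>+t. (\<integral>\<^sup>+u. ennreal ((cmod (f t))\<^sup>2) * ennreal (?N t u) \<partial>lborel) \<partial>lborel) = L2_sq f"
    unfolding L2_sq_def by (subst nn_integral_cmult) (simp_all add: iN)
  also have "(\<integral>\<^sup>+t. (\<integral>\<^sup>+u. ennreal ((cmod (f u))\<^sup>2) * ennreal (?N t u) \<partial>lborel) \<partial>lborel) =
     (\<integral>\<^sup>+u. (\<integral>\<^sup>+t. ennreal ((cmod (f u))\<^sup>2) * ennreal (?N t u) \<partial>lborel) \<partial>lborel)"
    by (rule lborel_pair.Fubini'[symmetric]) measurable
  also have "\<dots> = L2_sq f"
    unfolding L2_sq_def by (subst nn_integral_cmult) (simp_all add: iN)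
  also have "ennreal (1/2) * L2_sq f + ennreal (1/2) * L2_sq f = L2_sq f"
  proof -
    have "ennreal (1/2) + ennreal (1/2) = ennreal (1/2 + 1/2)" by (rule ennreal_plus[symmetric]) auto
    then show ?thesis by (simp only: distrib_right[symmetric]) simp
  qed
  finally show ?thesis by (simp add: ennreal_leI)
qed

lemma gauss_weight_tendsto_1: "(\<lambda>n. gauss_weight (Suc n) s) \<longlonglongrightarrow> 1"
proof -
  have "(\<lambda>n. s / real (Suc n)) \<longlonglongrightarrow> 0" using lim_const_over_n[of s] by (rule LIMSEQ_Suc)
  then have "(\<lambda>n. exp (- (s / real (Suc n))\<^sup>2 / 2)) \<longlonglongrightarrow> exp (- 0\<^sup>2 / 2)" by (intro tendsto_intros) auto
  then show ?thesis by (simp add: gauss_weight_def)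
qed

text \<open>Fatou as the weight widens. The transform is multiplied by the square root of the weight
  so that squaring restores the weighted integral already estimated; \<open>Suc n\<close> keeps the
  width positive.\<close>

lemma L2_sq_fourier_integral_le:
  assumes f: "integrable lborel f"
  shows "L2_sq (fourier_integral f) \<le> L2_sq f"
proof -
  have [measurable]: "f \<in> borel_measurable borel" using f by auto
  let ?g = "\<lambda>n s. complex_of_real (sqrt (gauss_weight (Suc n) s)) * fourier_integral f s"
  have "L2_sq (fourier_integral f) \<le> liminf (\<lambda>n. L2_sq (?g n))"
  proof (rule L2_sq_fatou)
    have "(\<lambda>n. ?g n s) \<longlonglongrightarrow> complex_of_real (sqrt 1) * fourier_integral f s" for s
      by (intro tendsto_intros gauss_weight_tendsto_1)
    then show "AE s in lborel. (\<lambda>n. ?g n s) \<longlonglongrightarrow> fourier_integral f s" by simp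
  qed measurable
  also have "\<dots> \<le> liminf (\<lambda>n::nat. L2_sq f)"
  proof (intro Liminf_mono always_eventually allI)
    fix n
    have "L2_sq (?g n) = (\<integral>\<^sup>+s. ennreal (gauss_weight (Suc n) s * (cmod (fourier_integral f s))\<^sup>2) \<partial>lborel)"
      unfolding L2_sq_def by (simp add: norm_mult power_mult_distrib gauss_weight_bounds)
    also have "\<dots> \<le> L2_sq f" by (rule L2_sq_gauss_fourier_le[OF _ f]) simp
    finally show "L2_sq (?g n) \<le> L2_sq f" .
  qed
  finally show ?thesis by (simp add: Liminf_const)
qed

lemma L2_sq_fourier_integral_diff_le:
  assumes "integrable lborel f" "integrable lborel g"
  shows "L2_sq (\<lambda>s. fourier_integral f s - fourier_integral g s) \<le> L2_sq (\<lambda>t. f t - g t)"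
  using L2_sq_fourier_integral_le[of "\<lambda>t. f t - g t"] assms
  by (simp add: fourier_integral_diff[OF assms, abs_def])

lemma L2_fourier_integral:
  assumes "integrable lborel f" "L2 f"
  shows "L2 (fourier_integral f)"
  using L2_sq_fourier_integral_le[OF assms(1)] assms(2) by (auto simp: L2_iff_L2_sq intro: le_less_trans)

section \<open>The Fourier--Plancherel transform\<close>

text \<open>Written exactly as the truncation inside \<open>FP\<close>, so that unfolding both
  definitions makes the terms match.\<close>

definition truncate :: "nat \<Rightarrow> (real \<Rightarrow> complex) \<Rightarrow> real \<Rightarrow> complex" where
  "truncate n f = (\<lambda>t. complex_of_real (indicator {- real n..real n} t) * f t)"

lemma truncate_measurable [measurable]:
  "f \<in> borel_measurable borel \<Longrightarrow> truncate n f \<in> borel_measurable borel"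
  unfolding truncate_def by measurable

lemma cmod_truncate_le: "cmod (truncate n f t) \<le> cmod (f t)"
  by (auto simp: truncate_def indicator_def norm_mult)

lemma L2_truncate: "L2 f \<Longrightarrow> L2 (truncate n f)"
  by (rule L2_bounded_by[where w=f and C=1]) (auto simp: cmod_truncate_le L2_iff_L2_sq)

text \<open>On a bounded interval L2 implies L1, because a <= 1 + a^2 and the constant 1 is
  integrable there.\<close>

lemma integrable_truncate:
  assumes "L2 f"
  shows "integrable lborel (truncate n f)"
proof (rule Bochner_Integration.integrable_bound)
  have [measurable]: "f \<in> borel_measurable borel" using assms by (rule L2_measurable)
  show "integrable lborel (\<lambda>t. indicator {- real n..real n} t + (cmod (f t))\<^sup>2)"
    using assms unfolding L2_def by (intro Bochner_Integration.integrable_add) auto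
  show "truncate n f \<in> borel_measurable lborel" by simp
  have "a \<le> 1 + a\<^sup>2" for a :: real
    using zero_le_power2[of "a - 1/2"] by (simp add: power2_eq_square algebra_simps)
  then show "AE t in lborel. norm (truncate n f t) \<le> norm (indicator {- real n..real n} t + (cmod (f t))\<^sup>2)"
    by (intro always_eventually allI) (simp add: truncate_def indicator_def norm_mult)
qed

lemma truncate_tendsto: "(\<lambda>n. truncate n f t) \<longlonglongrightarrow> f t"
proof (rule tendsto_eventually)
  obtain N :: nat where "\<bar>t\<bar> \<le> real N" using real_arch_simple by blast
  then show "eventually (\<lambda>n. truncate n f t = f t) sequentially"
    by (intro eventually_sequentiallyI[of N]) (auto simp: truncate_def indicator_def)
qed

lemma L2_sq_truncate_tendsto: "L2 f \<Longrightarrow> (\<lambda>n. L2_sq (\<lambda>t. truncate n f t - f t)) \<longlonglongrightarrow> 0"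
  by (rule L2_sq_dominated[where w=f and C=1]) (auto simp: truncate_tendsto cmod_truncate_le L2_iff_L2_sq)

text \<open>The choice in \<open>FP\<close> has a witness: truncations are Cauchy in mean square,
  the contraction property transfers this to their Fourier integrals, and completeness supplies the
  limit.\<close>

lemma FP_properties:
  assumes f: "L2 f"
  shows L2_FP: "L2 (FP f)"
    and FP_truncate_tendsto: "(\<lambda>n. L2_sq (\<lambda>s. FP f s - fourier_integral (truncate n f) s)) \<longlonglongrightarrow> 0"
proof -
  have [measurable]: "f \<in> borel_measurable borel" using f by (rule L2_measurable)
  define g where "g n = fourier_integral (truncate n f)" for n
  have g_L2: "L2 (g n)" for n unfolding g_def by (intro L2_fourier_integral integrable_truncate L2_truncate f)
  have [measurable]: "g n \<in> borel_measurable borel" for n using g_L2 by (rule L2_measurable)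
  have "\<exists>h. h \<in> borel_measurable borel \<and> (\<lambda>n. L2_sq (\<lambda>t. h t - g n t)) \<longlonglongrightarrow> 0"
  proof (rule L2_sq_cauchy_limit)
    fix e :: real assume e: "e > 0"
    \<comment> \<open>The share is e / 4 because the triangle inequality for squares doubles both
      terms.\<close>
    have "eventually (\<lambda>n. L2_sq (\<lambda>t. truncate n f t - f t) < ennreal (e / 4)) sequentially"
      using L2_sq_truncate_tendsto[OF f] by (rule order_tendstoD) (use e in simp)
    then obtain N where N: "\<And>n. n \<ge> N \<Longrightarrow> L2_sq (\<lambda>t. truncate n f t - f t) < ennreal (e / 4)"
      by (auto simp: eventually_sequentially)
    have "L2_sq (\<lambda>t. g m t - g n t) \<le> ennreal e" if "m \<ge> N" "n \<ge> N" for m n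
    proof -
      have "L2_sq (\<lambda>t. g m t - g n t) \<le> L2_sq (\<lambda>t. truncate m f t - truncate n f t)"
        unfolding g_def by (intro L2_sq_fourier_integral_diff_le integrable_truncate f)
      also have "\<dots> \<le> 2 * L2_sq (\<lambda>t. truncate m f t - f t) + 2 * L2_sq (\<lambda>t. f t - truncate n f t)"
        by (rule L2_sq_triangle) auto
      also have "\<dots> \<le> 2 * ennreal (e / 4) + 2 * ennreal (e / 4)"
        using N[of m] N[of n] that by (intro add_mono mult_left_mono) (auto simp: L2_sq_minus_commute[of f])
      also have "\<dots> = ennreal (2 * (e / 4) + 2 * (e / 4))"
      proof -
        have "ennreal (2 * (e / 4)) = 2 * ennreal (e / 4)" using e ennreal_mult[of 2 "e / 4"] by simp
        then show ?thesis using e by (subst ennreal_plus) (simp_all del: ennreal_plus)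
      qed
      finally show ?thesis by simp
    qed
    then show "\<exists>N. \<forall>m\<ge>N. \<forall>n\<ge>N. L2_sq (\<lambda>t. g m t - g n t) \<le> ennreal e" by blast
  qed simp
  then obtain h where h [measurable]: "h \<in> borel_measurable borel" and lim: "(\<lambda>n. L2_sq (\<lambda>t. h t - g n t)) \<longlonglongrightarrow> 0"
    by blast
  \<comment> \<open>Completeness gave only a measurable h; finite distance to a single g n makes it
    square integrable.\<close>
  have "eventually (\<lambda>n. L2_sq (\<lambda>t. h t - g n t) < 1) sequentially"
    using lim by (rule order_tendstoD) simp
  then obtain n where n: "L2_sq (\<lambda>t. h t - g n t) < 1" by (auto simp: eventually_sequentially)
  then have "L2 (\<lambda>t. h t - g n t)" by (auto simp: L2_iff_L2_sq intro: less_trans)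
  from L2_add[OF this g_L2[of n]] have "L2 h" by simp
  with lim have "L2 h \<and> (\<lambda>n. L2_norm (\<lambda>s. h s - g n s)) \<longlonglongrightarrow> 0"
    using g_L2 by (simp add: L2_norm_tendsto_0_iff L2_diff)
  then have *: "L2 (FP f) \<and> (\<lambda>n. L2_norm (\<lambda>s. FP f s - g n s)) \<longlonglongrightarrow> 0"
    unfolding FP_def g_def truncate_def
    by (rule someI[where P="\<lambda>h. L2 h \<and> (\<lambda>n. L2_norm (\<lambda>s. h s - fourier_integral
      (\<lambda>t. complex_of_real (indicator {- real n..real n} t) * f t) s)) \<longlonglongrightarrow> 0"])
  then show "L2 (FP f)" by simp
  show "(\<lambda>n. L2_sq (\<lambda>s. FP f s - fourier_integral (truncate n f) s)) \<longlonglongrightarrow> 0"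
    using * unfolding g_def[symmetric] by (subst L2_norm_tendsto_0_iff[symmetric]) (auto intro: L2_diff g_L2)
qed

lemma FP_measurable: "L2 f \<Longrightarrow> FP f \<in> borel_measurable borel"
  by (rule L2_measurable[OF L2_FP])

lemma ennreal_tendsto_add_0:
  fixes x y :: "nat \<Rightarrow> ennreal"
  assumes "x \<longlonglongrightarrow> 0" "y \<longlonglongrightarrow> 0" "a < \<infinity>" "b < \<infinity>" "\<And>n. z n \<le> a * x n + b * y n"
  shows "z \<longlonglongrightarrow> 0"
proof (rule tendsto_sandwich[OF _ _ tendsto_const])
  show "(\<lambda>n. a * x n + b * y n) \<longlonglongrightarrow> 0"
    using tendsto_add[OF ennreal_tendsto_cmult[OF assms(3,1)[unfolded infinity_ennreal_def]]
        ennreal_tendsto_cmult[OF assms(4,2)[unfolded infinity_ennreal_def]]] by simp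
qed (use assms(5) in auto)

text \<open>Any approximation of \<open>f\<close> by integrable L2 functions may replace the
  truncations, since the contraction property compares the two sequences. All later computations of
  \<open>FP\<close> go through this.\<close>

lemma FP_eqI:
  assumes f: "L2 f" and g: "L2 g" and fn: "\<And>n::nat. L2 (u n)" "\<And>n. integrable lborel (u n)"
    and l1: "(\<lambda>n. L2_sq (\<lambda>t. u n t - f t)) \<longlonglongrightarrow> 0"
    and l2: "(\<lambda>n. L2_sq (\<lambda>t. fourier_integral (u n) t - g t)) \<longlonglongrightarrow> 0"
  shows "ae_eq (FP f) g"
proof (rule L2_sq_tendsto_unique_AE[OF _ _ _ _ l2])
  have [measurable]: "f \<in> borel_measurable borel" "u n \<in> borel_measurable borel" "FP f \<in> borel_measurable borel" for n
    using f fn L2_FP[OF f] by (auto simp: L2_iff_L2_sq)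
  show "fourier_integral (u n) \<in> borel_measurable borel" for n by measurable
  show "FP f \<in> borel_measurable borel" "g \<in> borel_measurable borel" using f g by (auto intro: FP_measurable L2_measurable)
  have "(\<lambda>n. L2_sq (\<lambda>t. truncate n f t - u n t)) \<longlonglongrightarrow> 0"
    by (rule ennreal_tendsto_add_0[OF L2_sq_truncate_tendsto[OF f] l1, of 2 2])
       (use L2_sq_triangle[of "truncate _ f" f "u _"] L2_sq_minus_commute[of f "u _"] in auto)
  then show "(\<lambda>n. L2_sq (\<lambda>t. fourier_integral (u n) t - FP f t)) \<longlonglongrightarrow> 0"
  proof (rule ennreal_tendsto_add_0[OF FP_truncate_tendsto[OF f], of _ 2 2])
    fix n
    have "L2_sq (\<lambda>t. fourier_integral (u n) t - FP f t) = L2_sq (\<lambda>t. FP f t - fourier_integral (u n) t)"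
      by (rule L2_sq_minus_commute)
    also have "\<dots> \<le> 2 * L2_sq (\<lambda>s. FP f s - fourier_integral (truncate n f) s) +
         2 * L2_sq (\<lambda>s. fourier_integral (truncate n f) s - fourier_integral (u n) s)"
      by (rule L2_sq_triangle) auto
    also have "\<dots> \<le> 2 * L2_sq (\<lambda>s. FP f s - fourier_integral (truncate n f) s) + 2 * L2_sq (\<lambda>t. truncate n f t - u n t)"
      by (intro add_left_mono mult_left_mono L2_sq_fourier_integral_diff_le integrable_truncate f fn) auto
    finally show "L2_sq (\<lambda>t. fourier_integral (u n) t - FP f t) \<le> 2 * L2_sq (\<lambda>s. FP f s - fourier_integral (truncate n f) s) + 2 * L2_sq (\<lambda>t. truncate n f t - u n t)" .
  qed auto
qed

lemma FP_eq_fourier_integral: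
  assumes "L2 f" "integrable lborel f"
  shows "ae_eq (FP f) (fourier_integral f)"
  by (rule FP_eqI[where u="\<lambda>_. f"]) (use assms in \<open>auto intro: L2_fourier_integral simp: L2_sq_def\<close>)

text \<open>Compare through the Fourier integrals of the truncations and let n grow. The constant 8
  comes from the crude triangle inequality and is not sharp; the limit arguments rely only on its
  being finite.\<close>

lemma L2_sq_FP_diff_le:
  assumes f: "L2 f" and g: "L2 g"
  shows "L2_sq (\<lambda>s. FP f s - FP g s) \<le> 8 * L2_sq (\<lambda>t. f t - g t)"
proof -
  have [measurable]: "f \<in> borel_measurable borel" "g \<in> borel_measurable borel" "FP f \<in> borel_measurable borel" "FP g \<in> borel_measurable borel"
    using f g L2_FP[OF f] L2_FP[OF g] by (auto simp: L2_iff_L2_sq)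
  have "L2_sq (\<lambda>s. FP f s - FP g s) \<le> 2 * L2_sq (\<lambda>s. FP f s - fourier_integral (truncate n f) s)
     + (4 * L2_sq (\<lambda>s. FP g s - fourier_integral (truncate n g) s) + 8 * L2_sq (\<lambda>t. f t - g t))" for n
  proof -
    let ?f = "fourier_integral (truncate n f)" let ?g = "fourier_integral (truncate n g)"
    have "L2_sq (\<lambda>s. FP f s - FP g s) \<le> 2 * L2_sq (\<lambda>s. FP f s - ?f s) + 2 * L2_sq (\<lambda>s. ?f s - FP g s)"
      by (rule L2_sq_triangle) auto
    also have "L2_sq (\<lambda>s. ?f s - FP g s) \<le> 2 * L2_sq (\<lambda>s. ?f s - ?g s) + 2 * L2_sq (\<lambda>s. ?g s - FP g s)"
      by (rule L2_sq_triangle) auto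
    also have "L2_sq (\<lambda>s. ?g s - FP g s) = L2_sq (\<lambda>s. FP g s - ?g s)" by (rule L2_sq_minus_commute)
    also have "L2_sq (\<lambda>s. ?f s - ?g s) \<le> L2_sq (\<lambda>t. truncate n f t - truncate n g t)"
      by (intro L2_sq_fourier_integral_diff_le integrable_truncate f g)
    also have "\<dots> \<le> L2_sq (\<lambda>t. f t - g t)"
      by (rule L2_sq_mono) (auto simp: truncate_def indicator_def)
    also have "L2_sq (\<lambda>t. f t - g t) \<le> 2 * L2_sq (\<lambda>t. f t - g t)" by (simp add: mult_2)
    finally show ?thesis by (simp add: distrib_left mult.assoc[symmetric] add_ac add_left_mono mult_left_mono)
  qed
  moreover have "(\<lambda>n. 2 * L2_sq (\<lambda>s. FP f s - fourier_integral (truncate n f) s)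
     + (4 * L2_sq (\<lambda>s. FP g s - fourier_integral (truncate n g) s) + 8 * L2_sq (\<lambda>t. f t - g t))) \<longlonglongrightarrow> 2 * 0 + (4 * 0 + 8 * L2_sq (\<lambda>t. f t - g t))"
    by (intro tendsto_add ennreal_tendsto_cmult tendsto_const FP_truncate_tendsto f g) auto
  ultimately show ?thesis using LIMSEQ_le_const by (metis (no_types, lifting) add_0 mult_zero_right)
qed

lemma FP_cong: "L2 f \<Longrightarrow> L2 g \<Longrightarrow> ae_eq f g \<Longrightarrow> ae_eq (FP f) (FP g)"
  using L2_sq_FP_diff_le[of f g] by (simp add: ae_eq_iff_L2_sq FP_measurable L2_measurable)

lemma FP_add:
  assumes f: "L2 f" and g: "L2 g"
  shows "ae_eq (FP (\<lambda>t. f t + c * g t)) (\<lambda>s. FP f s + c * FP g s)"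
proof (rule FP_eqI[where u="\<lambda>n t. truncate n f t + c * truncate n g t"])
  have [measurable]: "f \<in> borel_measurable borel" "g \<in> borel_measurable borel" "FP f \<in> borel_measurable borel" "FP g \<in> borel_measurable borel"
    using f g L2_FP[OF f] L2_FP[OF g] by (auto simp: L2_iff_L2_sq)
  show "L2 (\<lambda>t. f t + c * g t)" "L2 (\<lambda>s. FP f s + c * FP g s)" "\<And>n. L2 (\<lambda>t. truncate n f t + c * truncate n g t)"
    by (intro L2_add L2_cmult L2_FP L2_truncate f g)+
  show "\<And>n. integrable lborel (\<lambda>t. truncate n f t + c * truncate n g t)"
    using integrable_truncate f g by simp
  have *: "L2_sq (\<lambda>t. a t + c * b t - (x t + c * y t)) \<le> 2 * L2_sq (\<lambda>t. a t - x t) + (2 * ennreal ((cmod c)\<^sup>2)) * L2_sq (\<lambda>t. b t - y t)"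
    if [measurable]: "a \<in> borel_measurable borel" "b \<in> borel_measurable borel" "x \<in> borel_measurable borel" "y \<in> borel_measurable borel" for a b x y
  proof -
    have "L2_sq (\<lambda>t. a t + c * b t - (x t + c * y t)) = L2_sq (\<lambda>t. (a t - x t) + c * (b t - y t))"
      by (simp add: algebra_simps)
    also have "\<dots> \<le> 2 * L2_sq (\<lambda>t. a t - x t) + 2 * L2_sq (\<lambda>t. c * (b t - y t))" by (rule L2_sq_add_le) auto
    finally show ?thesis by (simp add: L2_sq_scale mult.assoc)
  qed
  show "(\<lambda>n. L2_sq (\<lambda>t. truncate n f t + c * truncate n g t - (f t + c * g t))) \<longlonglongrightarrow> 0"
    by (rule ennreal_tendsto_add_0[OF L2_sq_truncate_tendsto[OF f] L2_sq_truncate_tendsto[OF g] _ _ *])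
       (auto simp: ennreal_mult_less_top)
  show "(\<lambda>n. L2_sq (\<lambda>t. fourier_integral (\<lambda>t. truncate n f t + c * truncate n g t) t - (FP f t + c * FP g t))) \<longlonglongrightarrow> 0"
    unfolding fourier_integral_add[OF integrable_truncate[OF f] integrable_truncate[OF g]]
    by (rule ennreal_tendsto_add_0[OF FP_truncate_tendsto[OF f] FP_truncate_tendsto[OF g] _ _
           *[THEN order_trans, OF _ _ _ _ eq_refl], of 2 "2 * ennreal ((cmod c)\<^sup>2)"])
       (auto simp: ennreal_mult_less_top L2_sq_minus_commute[of "FP _"])
qed

section \<open>Translation and dilation under \<open>FP\<close>\<close>

lemma L2_sq_affine:
  assumes [measurable]: "f \<in> borel_measurable borel" and c: "c \<noteq> 0"
  shows "L2_sq f = ennreal \<bar>c\<bar> * L2_sq (\<lambda>t. f (a + c * t))"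
  unfolding L2_sq_def by (rule nn_integral_real_affine) (use c in auto)

lemma L2_sq_reflect:
  assumes "f \<in> borel_measurable borel"
  shows "L2_sq (\<lambda>t. f (- t)) = L2_sq f"
  using L2_sq_affine[OF assms, of "-1" 0] by simp

lemma L2_affine:
  assumes "L2 f" "c \<noteq> 0"
  shows "L2 (\<lambda>t. f (a + c * t))"
proof -
  have [measurable]: "f \<in> borel_measurable borel" using assms by (simp add: L2_iff_L2_sq)
  have "L2_sq (\<lambda>t. f (a + c * t)) < \<infinity>"
    using assms L2_sq_affine[of f c a] by (auto simp: L2_iff_L2_sq ennreal_mult_less_top)
  then show ?thesis by (simp add: L2_iff_L2_sq)
qed

lemma ae_eq_affine:
  assumes "ae_eq f g" "f \<in> borel_measurable borel" "g \<in> borel_measurable borel" "c \<noteq> 0"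
  shows "ae_eq (\<lambda>t. f (a + c * t)) (\<lambda>t. g (a + c * t))"
  using assms unfolding ae_eq_def by (intro AE_borel_affine) auto

lemma fourier_integral_transl:
  assumes [measurable]: "f \<in> borel_measurable borel"
  shows "fourier_integral (transl f) s = exp (- \<i> * complex_of_real s) * fourier_integral f s"
proof -
  have "(LINT t|lborel. exp (- \<i> * complex_of_real (s * t)) * f (t - 1))
     = \<bar>1\<bar> *\<^sub>R (LINT t|lborel. exp (- \<i> * complex_of_real (s * (1 + 1 * t))) * f (1 + 1 * t - 1))"
    by (rule lborel_integral_real_affine) simp
  also have "\<dots> = (LINT t|lborel. exp (- \<i> * complex_of_real s) * (exp (- \<i> * complex_of_real (s * t)) * f t))"
    by (simp add: ring_distribs exp_diff exp_minus mult_ac divide_inverse)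
  also have "\<dots> = exp (- \<i> * complex_of_real s) * (LINT t|lborel. exp (- \<i> * complex_of_real (s * t)) * f t)"
    by (rule integral_mult_right_zero)
  finally show ?thesis by (simp add: fourier_integral_def transl_def)
qed

lemma fourier_integral_dil:
  assumes [measurable]: "f \<in> borel_measurable borel"
  shows "fourier_integral (dil f) s = complex_of_real (1 / sqrt 2) * fourier_integral f (s / 2)"
proof -
  have "(LINT t|lborel. exp (- \<i> * complex_of_real (s / 2 * t)) * f t)
     = \<bar>2\<bar> *\<^sub>R (LINT t|lborel. exp (- \<i> * complex_of_real (s / 2 * (0 + 2 * t))) * f (0 + 2 * t))"
    by (rule lborel_integral_real_affine) simp
  then have *: "(LINT t|lborel. exp (- \<i> * complex_of_real (s * t)) * f (2 * t)) =
    (LINT t|lborel. exp (- \<i> * complex_of_real (s / 2 * t)) * f t) / 2"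
    by (simp add: scaleR_conv_of_real)
  have "(LINT t|lborel. exp (- \<i> * complex_of_real (s * t)) * (complex_of_real (sqrt 2) * f (2 * t)))
    = (LINT t|lborel. complex_of_real (sqrt 2) * (exp (- \<i> * complex_of_real (s * t)) * f (2 * t)))"
    by (simp add: mult_ac)
  also have "\<dots> = complex_of_real (sqrt 2) * (LINT t|lborel. exp (- \<i> * complex_of_real (s * t)) * f (2 * t))"
    by (rule integral_mult_right_zero)
  also have "\<dots> = complex_of_real (sqrt 2 / 2) * (LINT t|lborel. exp (- \<i> * complex_of_real (s / 2 * t)) * f t)"
    unfolding * by simp
  also have "sqrt 2 / 2 = 1 / sqrt 2" by (simp add: field_simps)
  finally show ?thesis by (simp add: fourier_integral_def dil_def)
qed

lemma L2_transl: "L2 f \<Longrightarrow> L2 (transl f)"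
  using L2_affine[of f 1 "-1"] by (simp add: transl_def)

lemma L2_dil: "L2 f \<Longrightarrow> L2 (dil f)"
  using L2_cmult[OF L2_affine[of f 2 0]] by (simp add: dil_def)

lemma integrable_transl: "integrable lborel f \<Longrightarrow> integrable lborel (transl f)"
  using lborel_integrable_real_affine[of f 1 "-1"] by (simp add: transl_def)

lemma integrable_dil: "integrable lborel f \<Longrightarrow> integrable lborel (dil f)"
  using lborel_integrable_real_affine[of f 2 0] by (simp add: dil_def)

text \<open>The approximants are translates of truncations rather than truncations of the translate,
  which \<open>FP_eqI\<close> permits. Translation and the unimodular factor both preserve the
  squared norm, so both errors are those of the truncations.\<close>

lemma FP_transl:
  assumes f: "L2 f"
  shows "ae_eq (FP (transl f)) (\<lambda>s. exp (- \<i> * complex_of_real s) * FP f s)"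
proof (rule FP_eqI[where u="\<lambda>n. transl (truncate n f)"])
  have [measurable]: "f \<in> borel_measurable borel" "FP f \<in> borel_measurable borel" using f by (auto simp: FP_measurable L2_measurable)
  show "L2 (transl f)" by (rule L2_transl[OF f])
  show "L2 (\<lambda>s. exp (- \<i> * complex_of_real s) * FP f s)"
    by (rule L2_bounded_by[where C=1, OF L2_FP[OF f]]) (auto simp: norm_mult)
  show "L2 (transl (truncate n f))" "integrable lborel (transl (truncate n f))" for n
    by (intro L2_transl L2_truncate integrable_transl integrable_truncate f)+
  have "L2_sq (\<lambda>t. transl (truncate n f) t - transl f t) = L2_sq (\<lambda>t. truncate n f t - f t)" for n
    using L2_sq_affine[of "\<lambda>t. truncate n f t - f t" 1 "-1"] by (simp add: transl_def)
  then show "(\<lambda>n. L2_sq (\<lambda>t. transl (truncate n f) t - transl f t)) \<longlonglongrightarrow> 0" using L2_sq_truncate_tendsto[OF f] by simp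
  have "L2_sq (\<lambda>s. fourier_integral (transl (truncate n f)) s - exp (- \<i> * complex_of_real s) * FP f s)
     = L2_sq (\<lambda>s. FP f s - fourier_integral (truncate n f) s)" for n
  proof (rule L2_sq_cong_AE, intro always_eventually allI)
    fix s
    have "fourier_integral (transl (truncate n f)) s - exp (- \<i> * complex_of_real s) * FP f s
      = exp (- \<i> * complex_of_real s) * (fourier_integral (truncate n f) s - FP f s)"
      by (subst fourier_integral_transl) (simp_all add: algebra_simps)
    then show "cmod (fourier_integral (transl (truncate n f)) s - exp (- \<i> * complex_of_real s) * FP f s)
      = cmod (FP f s - fourier_integral (truncate n f) s)"
      by (simp add: norm_mult norm_minus_commute)
  qed
  then show "(\<lambda>n. L2_sq (\<lambda>s. fourier_integral (transl (truncate n f)) s - exp (- \<i> * complex_of_real s) * FP f s)) \<longlonglongrightarrow> 0"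
    using FP_truncate_tendsto[OF f] by simp
qed

text \<open>The argument of \<open>FP_transl\<close> with dilated truncations; the factors sqrt 2
  and 1 / sqrt 2 make the dilations on the two sides isometric.\<close>

lemma FP_dil:
  assumes f: "L2 f"
  shows "ae_eq (FP (dil f)) (\<lambda>s. complex_of_real (1 / sqrt 2) * FP f (s / 2))"
proof (rule FP_eqI[where u="\<lambda>n. dil (truncate n f)"])
  have [measurable]: "f \<in> borel_measurable borel" "FP f \<in> borel_measurable borel" using f by (auto simp: FP_measurable L2_measurable)
  show "L2 (dil f)" by (rule L2_dil[OF f])
  show "L2 (\<lambda>s. complex_of_real (1 / sqrt 2) * FP f (s / 2))"
    using L2_cmult[OF L2_affine[OF L2_FP[OF f], of "1/2" 0], of "complex_of_real (1 / sqrt 2)"] by simp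
  show "L2 (dil (truncate n f))" "integrable lborel (dil (truncate n f))" for n
    by (intro L2_dil L2_truncate integrable_dil integrable_truncate f)+
  have "L2_sq (\<lambda>t. dil (truncate n f) t - dil f t) \<le> 2 * L2_sq (\<lambda>t. truncate n f t - f t) + 0 * L2_sq (\<lambda>t. truncate n f t - f t)" for n
  proof -
    have "L2_sq (\<lambda>t. dil (truncate n f) t - dil f t) = L2_sq (\<lambda>t. sqrt 2 * (truncate n f (0 + 2 * t) - f (0 + 2 * t)))"
      by (simp add: dil_def algebra_simps)
    also have "\<dots> = L2_sq (\<lambda>t. truncate n f t - f t)"
      by (subst L2_sq_scale, simp, subst L2_sq_affine[of "\<lambda>t. truncate n f t - f t" 2 0]) simp_all
    finally show ?thesis by (simp add: mult_2)
  qed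
  then show "(\<lambda>n. L2_sq (\<lambda>t. dil (truncate n f) t - dil f t)) \<longlonglongrightarrow> 0"
    by (rule ennreal_tendsto_add_0[OF L2_sq_truncate_tendsto[OF f] L2_sq_truncate_tendsto[OF f], rotated 2]) auto
  have "L2_sq (\<lambda>s. fourier_integral (dil (truncate n f)) s - complex_of_real (1 / sqrt 2) * FP f (s / 2))
     = L2_sq (\<lambda>s. FP f s - fourier_integral (truncate n f) s)" for n
  proof -
    have "L2_sq (\<lambda>s. fourier_integral (dil (truncate n f)) s - complex_of_real (1 / sqrt 2) * FP f (s / 2))
      = L2_sq (\<lambda>s. complex_of_real (1 / sqrt 2) * (fourier_integral (truncate n f) (0 + 1/2 * s) - FP f (0 + 1/2 * s)))"
      by (subst fourier_integral_dil) (simp_all add: algebra_simps)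
    also have "\<dots> = ennreal (1/2) * L2_sq (\<lambda>s. fourier_integral (truncate n f) (0 + 1/2 * s) - FP f (0 + 1/2 * s))"
      by (subst L2_sq_scale) (simp_all add: power_divide norm_divide del: ennreal_half)
    also have "\<dots> = L2_sq (\<lambda>s. fourier_integral (truncate n f) s - FP f s)"
      by (subst L2_sq_affine[of "\<lambda>s. fourier_integral (truncate n f) s - FP f s" "1/2" 0]) simp_all
    also have "\<dots> = L2_sq (\<lambda>s. FP f s - fourier_integral (truncate n f) s)" by (rule L2_sq_minus_commute)
    finally show ?thesis .
  qed
  then show "(\<lambda>n. L2_sq (\<lambda>s. fourier_integral (dil (truncate n f)) s - complex_of_real (1 / sqrt 2) * FP f (s / 2))) \<longlonglongrightarrow> 0"
    using FP_truncate_tendsto[OF f] by simp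
qed

section \<open>Inversion of the Fourier--Plancherel transform\<close>

text \<open>A functional monotone class argument: continuous ramps yield open rays, Dynkin's lemma
  yields Borel sets, linearity yields simple functions, and a bounded limit yields the rest. It
  serves both the inversion formula and the commutant.\<close>

lemma bounded_borel_induct:
  fixes P :: "(real \<Rightarrow> complex) \<Rightarrow> bool"
  assumes cont: "\<And>(\<phi>::real\<Rightarrow>real) C. continuous_on UNIV \<phi> \<Longrightarrow> (\<And>t. \<bar>\<phi> t\<bar> \<le> C) \<Longrightarrow> P (\<lambda>t. complex_of_real (\<phi> t))"
    and lin: "\<And>f g c. P f \<Longrightarrow> P g \<Longrightarrow> P (\<lambda>t. f t + c * g t)"
    and lim: "\<And>f g C. (\<And>n::nat. P (f n)) \<Longrightarrow> (\<And>n t. cmod (f n t) \<le> C) \<Longrightarrow> (\<And>t. (\<lambda>n. f n t) \<longlonglongrightarrow> g t) \<Longrightarrow> P g"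
    and \<phi>: "\<phi> \<in> borel_measurable borel" "\<And>t. cmod (\<phi> t) \<le> C"
  shows "P \<phi>"
proof -
  have one: "P (\<lambda>t. 1)" using cont[of "\<lambda>t. 1" 1] by simp
  have zero: "P (\<lambda>t. 0)" using lin[OF one one, of "-1"] by simp
  have sums: "P (\<lambda>t. \<Sum>i\<in>I. c i * f i t)" if "finite I" "\<And>i. i \<in> I \<Longrightarrow> P (f i)" for I :: "'i set" and c f
    using that
  proof (induction I rule: finite_induct)
    case (insert x I)
    then have "P (\<lambda>t. (\<Sum>i\<in>I. c i * f i t) + c x * f x t)" by (intro lin) auto
    with insert show ?case by (simp add: add.commute)
  qed (simp add: zero)
  have sets: "P (\<lambda>t. complex_of_real (indicator B t))" if "B \<in> sets borel" for B
  proof -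
    have B: "B \<in> sigma_sets UNIV (range (greaterThan :: real \<Rightarrow> _))"
      using that unfolding borel_Ioi by simp
    show ?thesis
    proof (rule sigma_sets_induct_disjoint[OF _ _ B])
      \<comment> \<open>The open rays generate the Borel sets and are stable under intersection, so
        closure under complements and disjoint countable unions suffices.\<close>
      have "{a<..} \<inter> {b<..} = {max a b<..}" for a b :: real by auto
      then show "Int_stable (range (greaterThan :: real \<Rightarrow> _))" by (auto simp: Int_stable_def)
      show "P (\<lambda>t. complex_of_real (indicator {} t))" using zero by simp
      show "P (\<lambda>t. complex_of_real (indicator A t))" if A: "A \<in> range greaterThan" for A
      proof -
        obtain a where a: "A = {a<..}" using A by auto
        show ?thesis
        proof (rule lim)
          \<comment> \<open>For n > 0 these ramps vanish up to a and equal 1 from a + 1/n on; they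
            increase to the indicator of the open ray.\<close>
          let ?f = "\<lambda>n t. max 0 (min 1 (real n * (t - a)))"
          show "P (\<lambda>t. complex_of_real (?f n t))" for n
            by (rule cont[where C=1]) (auto intro!: continuous_intros)
          show "cmod (complex_of_real (?f n t)) \<le> 1" for n t by simp
          show "(\<lambda>n. complex_of_real (?f n t)) \<longlonglongrightarrow> complex_of_real (indicator A t)" for t
          proof (cases "t > a")
            case True
            obtain N :: nat where N: "1 < real N * (t - a)" using reals_Archimedean3[of "t - a"] True by auto
            have "?f n t = indicator A t" if "n \<ge> N" for n
            proof -
              have "real N * (t - a) \<le> real n * (t - a)" using that True by (intro mult_right_mono) auto
              then have "1 \<le> real n * (t - a)" using N by linarith
              then show ?thesis using True by (simp add: a min_def)
            qed
            then show ?thesis by (intro tendsto_eventually eventually_sequentiallyI[of N]) simp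
          next
            case False
            then have "real n * (t - a) \<le> 0" for n by (intro mult_nonneg_nonpos) auto
            then have "?f n t = 0" for n by (meson max_absorb1 min.coboundedI2)
            then have "?f n t = indicator A t" for n using False by (simp add: a)
            then show ?thesis by simp
          qed
        qed
      qed
      show "P (\<lambda>t. complex_of_real (indicator (UNIV - A) t))" if "P (\<lambda>t. complex_of_real (indicator A t))" for A
        using lin[OF one that, of "-1"] by (simp add: indicator_diff)
      show "P (\<lambda>t. complex_of_real (indicator (\<Union>i. A i) t))"
        if d: "disjoint_family A" and A: "\<And>i::nat. P (\<lambda>t. complex_of_real (indicator (A i) t))" for A
      proof (rule lim)
        \<comment> \<open>Disjointness turns partial sums into indicators, which gives the uniform
          bound 1 required for the limit.\<close>
        have *: "(\<Sum>i<n. indicator (A i) t) = (indicator (\<Union>i<n. A i) t :: real)" for n t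
          using d by (intro indicator_UN_disjoint[symmetric]) (auto simp: disjoint_family_on_def)
        show "P (\<lambda>t. complex_of_real (\<Sum>i<n. indicator (A i) t))" for n
          using sums[of "{..<n}" "\<lambda>i t. complex_of_real (indicator (A i) t)" "\<lambda>_. 1"] A by simp
        show "cmod (complex_of_real (\<Sum>i<n. indicator (A i) t)) \<le> 1" for n t
          unfolding * by (simp add: indicator_def)
        show "(\<lambda>n. complex_of_real (\<Sum>i<n. indicator (A i) t)) \<longlonglongrightarrow> complex_of_real (indicator (\<Union>i. A i) t)" for t
          unfolding * using LIMSEQ_indicator_UN[of A t] by (intro tendsto_of_real)
      qed
    qed auto
  qed
  obtain s where s: "\<And>i. simple_function borel (s i)" "\<And>x. (\<lambda>i. s i x) \<longlonglongrightarrow> \<phi> x"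
    "\<And>i x. cmod (s i x) \<le> 2 * cmod (\<phi> x)"
    using borel_measurable_implies_sequence_metric[OF \<phi>(1), of 0] by (auto simp: dist_norm)
  show ?thesis
  proof (rule lim[OF _ _ s(2)])
    show "cmod (s i t) \<le> 2 * C" for i t using s(3)[of i t] \<phi>(2)[of t] by simp
    show "P (s i)" for i
    proof -
      have fin: "finite (range (s i))" using s(1)[of i] by (simp add: simple_function_def)
      have "P (\<lambda>t. \<Sum>y\<in>range (s i). y * complex_of_real (indicator (s i -` {y}) t))"
      proof (rule sums[OF fin])
        fix y assume "y \<in> range (s i)"
        then show "P (\<lambda>t. complex_of_real (indicator (s i -` {y}) t))"
          using s(1)[of i] by (intro sets) (auto simp: simple_function_def)
      qed
      also have "(\<lambda>t. \<Sum>y\<in>range (s i). y * complex_of_real (indicator (s i -` {y}) t)) = s i"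
      proof
        fix t
        have "(\<Sum>y\<in>range (s i). y * complex_of_real (indicator (s i -` {y}) t)) = (\<Sum>y\<in>range (s i). if y = s i t then y else 0)"
          by (intro sum.cong) (auto simp: indicator_def)
        then show "(\<Sum>y\<in>range (s i). y * complex_of_real (indicator (s i -` {y}) t)) = s i t"
          using fin by (simp add: sum.delta)
      qed
      finally show ?thesis .
    qed
  qed
qed

section \<open>Bounded multiples of a Gaussian as a dense class in L2\<close>

definition gaussian :: "real \<Rightarrow> complex" where
  "gaussian t = complex_of_real (gauss_weight 1 t)"

lemma gaussian_measurable [measurable]: "gaussian \<in> borel_measurable borel"
  unfolding gaussian_def[abs_def] by measurable

lemma gaussian_nonzero: "gaussian t \<noteq> 0"
  by (simp add: gaussian_def gauss_weight_def)

lemma cmod_gaussian: "cmod (gaussian t) = gauss_weight 1 t"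
  by (simp add: gaussian_def gauss_weight_bounds)

lemma integrable_gaussian: "integrable lborel gaussian"
  unfolding gaussian_def[abs_def] using integrable_gauss_weight[of 1] by simp

lemma L2_if_bounded_integrable:
  assumes f: "integrable lborel f" and b: "\<And>t. cmod (f t) \<le> C"
  shows "L2 f"
proof -
  have [measurable]: "f \<in> borel_measurable borel" using f by auto
  have "integrable lborel (\<lambda>t. (cmod (f t))\<^sup>2)"
  proof (rule Bochner_Integration.integrable_bound)
    show "integrable lborel (\<lambda>t. C * cmod (f t))" using f by simp
    have "0 \<le> C" using b[of 0] norm_ge_zero order_trans by blast
    then show "AE t in lborel. norm ((cmod (f t))\<^sup>2) \<le> norm (C * cmod (f t))"
      using b by (intro always_eventually allI) (simp add: power2_eq_square mult_right_mono)
  qed measurable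
  then show ?thesis by (simp add: L2_def)
qed

lemma L2_gaussian: "L2 gaussian"
  by (rule L2_if_bounded_integrable[OF integrable_gaussian, of 1]) (simp add: cmod_gaussian gauss_weight_bounds)

lemma L2_bounded_mult:
  assumes "L2 f" and [measurable]: "\<phi> \<in> borel_measurable borel" and b: "AE t in lborel. cmod (\<phi> t) \<le> C"
  shows "L2 (\<lambda>t. \<phi> t * f t)"
proof (rule L2_bounded_by[OF assms(1)])
  have [measurable]: "f \<in> borel_measurable borel" using assms by (simp add: L2_iff_L2_sq)
  show "(\<lambda>t. \<phi> t * f t) \<in> borel_measurable borel" by measurable
  show "AE t in lborel. cmod (\<phi> t * f t) \<le> C * cmod (f t)"
    using b by eventually_elim (simp add: norm_mult mult_right_mono)
qed

lemma L2_sq_bounded_limit: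
  assumes f: "L2 f" and [measurable]: "\<And>n. \<phi> n \<in> borel_measurable borel"
    and b: "\<And>n t. cmod (\<phi> n t) \<le> C" and l: "\<And>t. (\<lambda>n. \<phi> n t) \<longlonglongrightarrow> \<psi> t"
  shows "(\<lambda>n. L2_sq (\<lambda>t. \<phi> n t * f t - \<psi> t * f t)) \<longlonglongrightarrow> 0"
proof (rule L2_sq_dominated[OF _ _ _ _ f])
  have [measurable]: "f \<in> borel_measurable borel" using f by (simp add: L2_iff_L2_sq)
  have [measurable]: "\<psi> \<in> borel_measurable borel" by (rule borel_measurable_LIMSEQ_metric[where f=\<phi>]) (auto simp: l)
  show "(\<lambda>t. \<phi> n t * f t) \<in> borel_measurable borel" "(\<lambda>t. \<psi> t * f t) \<in> borel_measurable borel" for n by measurable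
  show "AE t in lborel. (\<lambda>n. \<phi> n t * f t) \<longlonglongrightarrow> \<psi> t * f t" by (intro always_eventually allI tendsto_intros l)
  show "AE t in lborel. cmod (\<phi> n t * f t) \<le> C * cmod (f t)" for n
    using b by (simp add: norm_mult mult_right_mono)
qed

text \<open>The Gaussian has no zeros, so f is a quotient q times it. Replacing q by 0 where |q| > n
  gives bounded factors whose products are dominated by f and at each point eventually equal
  f.\<close>

lemma L2_approx_gaussian:
  assumes f: "L2 f"
  obtains \<phi> where "\<And>n::nat. \<phi> n \<in> borel_measurable borel" "\<And>n t. cmod (\<phi> n t) \<le> real n"
    "(\<lambda>n. L2_sq (\<lambda>t. \<phi> n t * gaussian t - f t)) \<longlonglongrightarrow> 0"
proof
  have [measurable]: "f \<in> borel_measurable borel" using f by (simp add: L2_iff_L2_sq)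
  define q where "q t = f t / gaussian t" for t
  have [measurable]: "q \<in> borel_measurable borel" unfolding q_def by measurable
  have q: "q t * gaussian t = f t" for t by (simp add: q_def gaussian_nonzero)
  let ?p = "\<lambda>n t. if cmod (q t) \<le> real n then q t else 0"
  show "?p n \<in> borel_measurable borel" for n by measurable
  show "cmod (?p n t) \<le> real n" for n t by auto
  show "(\<lambda>n. L2_sq (\<lambda>t. ?p n t * gaussian t - f t)) \<longlonglongrightarrow> 0"
  proof (rule L2_sq_dominated[OF _ _ _ _ f, where C=1])
    show "AE t in lborel. (\<lambda>n. ?p n t * gaussian t) \<longlonglongrightarrow> f t"
    proof (rule always_eventually, rule allI, rule tendsto_eventually)
      fix t
      obtain N :: nat where "cmod (q t) \<le> real N" using real_arch_simple by blast
      then show "eventually (\<lambda>n. ?p n t * gaussian t = f t) sequentially"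
        by (intro eventually_sequentiallyI[of N]) (auto simp: q)
    qed
    show "AE t in lborel. cmod (?p n t * gaussian t) \<le> 1 * cmod (f t)" for n
      by (auto simp: q)
  qed measurable
qed

text \<open>The substitution t = -u + z / (n + 1) moves n from the kernel into the argument of f;
  dominated convergence against a fixed normal density finishes.\<close>

lemma gauss_convolution_tendsto:
  assumes f: "continuous_on UNIV f" and b: "\<And>t. cmod (f t) \<le> C"
  shows "(\<lambda>n. LINT t|lborel. f t * complex_of_real (gauss_kernel (Suc n) (t + u))) \<longlonglongrightarrow> f (- u)"
proof -
  have [measurable]: "f \<in> borel_measurable borel" using f by (rule borel_measurable_continuous_onI)
  have eq: "(LINT t|lborel. f t * complex_of_real (gauss_kernel (Suc n) (t + u)))
     = (LINT z|lborel. f (- u + z / Suc n) * complex_of_real (std_normal_density z))" for n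
  proof -
    have "(LINT t|lborel. f t * complex_of_real (gauss_kernel (Suc n) (t + u))) =
      \<bar>1 / Suc n\<bar> *\<^sub>R (LINT z|lborel. f (- u + 1 / Suc n * z) * complex_of_real (gauss_kernel (Suc n) (- u + 1 / Suc n * z + u)))"
      by (rule lborel_integral_real_affine) simp
    also have "\<dots> = (LINT z|lborel. complex_of_real (1 / Suc n) * (f (- u + 1 / Suc n * z) * complex_of_real (gauss_kernel (Suc n) (- u + 1 / Suc n * z + u))))"
      by (subst integral_mult_right_zero) (simp add: scaleR_conv_of_real)
    also have "\<dots> = (LINT z|lborel. f (- u + z / Suc n) * complex_of_real (std_normal_density z))"
    proof (intro Bochner_Integration.integral_cong refl)
      fix z
      have "gauss_kernel (Suc n) (- u + 1 / Suc n * z + u) = Suc n * std_normal_density z"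
        by (simp add: gauss_kernel_def del: of_nat_Suc)
      then show "complex_of_real (1 / Suc n) * (f (- u + 1 / Suc n * z) * complex_of_real (gauss_kernel (Suc n) (- u + 1 / Suc n * z + u)))
         = f (- u + z / Suc n) * complex_of_real (std_normal_density z)"
        by (simp del: of_nat_Suc)
    qed
    finally show ?thesis .
  qed
  have "(\<lambda>n. LINT z|lborel. f (- u + z / Suc n) * complex_of_real (std_normal_density z))
     \<longlonglongrightarrow> (LINT z|lborel. f (- u) * complex_of_real (std_normal_density z))"
  proof (rule integral_dominated_convergence)
    show "integrable lborel (\<lambda>z. C * std_normal_density z)" by simp
    show "AE z in lborel. norm (f (- u + z / Suc n) * complex_of_real (std_normal_density z)) \<le> C * std_normal_density z" for n
      using b by (intro always_eventually allI) (simp add: norm_mult mult_right_mono)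
    show "AE z in lborel. (\<lambda>n. f (- u + z / Suc n) * complex_of_real (std_normal_density z)) \<longlonglongrightarrow> f (- u) * complex_of_real (std_normal_density z)"
    proof (intro always_eventually allI tendsto_mult tendsto_const)
      fix z
      have "(\<lambda>n. - u + z / Suc n) \<longlonglongrightarrow> - u + 0"
        by (intro tendsto_add tendsto_const LIMSEQ_Suc[OF lim_const_over_n])
      then have "(\<lambda>n. - u + z / Suc n) \<longlonglongrightarrow> - u" by simp
      moreover have "isCont f (- u)" using f by (simp add: continuous_on_eq_continuous_at)
      ultimately show "(\<lambda>n. f (- u + z / Suc n)) \<longlonglongrightarrow> f (- u)" using isCont_tendsto_compose by blast
    qed
  qed measurable
  also have "(LINT z|lborel. f (- u) * complex_of_real (std_normal_density z)) = f (- u)"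
    by (subst integral_mult_right_zero) (simp add: integral_complex_of_real)
  finally show ?thesis unfolding eq .
qed

text \<open>The transform of f need not be integrable, so it is first multiplied by Gaussian
  weights. The Fourier integrals of the weighted functions tend pointwise to f (-u) by smoothing and
  in mean square to \<open>FP\<close> of the transform, hence the limits agree a.e.\<close>

lemma FP_FP_continuous:
  assumes f: "continuous_on UNIV f" and b: "\<And>t. cmod (f t) \<le> C" and i: "integrable lborel f"
  shows "ae_eq (FP (FP f)) (\<lambda>u. f (- u))"
proof -
  have fL2: "L2 f" by (rule L2_if_bounded_integrable[OF i b])
  let ?F = "fourier_integral f"
  have FL2: "L2 ?F" by (rule L2_fourier_integral[OF i fL2])
  have [measurable]: "f \<in> borel_measurable borel" "?F \<in> borel_measurable borel" "FP ?F \<in> borel_measurable borel"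
    using fL2 FL2 by (auto simp: L2_measurable FP_measurable)
  define g where "g n s = complex_of_real (gauss_weight (Suc n) s) * ?F s" for n s
  have gi: "integrable lborel (g n)" for n
    unfolding g_def by (rule integrable_gauss_weight_mult) (auto intro: fourier_integral_bound[OF i])
  have gL2: "L2 (g n)" for n
    unfolding g_def by (rule L2_bounded_mult[OF FL2, where C=1]) (auto simp: gauss_weight_bounds)
  have "(\<lambda>n. L2_sq (\<lambda>s. g n s - 1 * ?F s)) \<longlonglongrightarrow> 0"
    unfolding g_def
  proof (rule L2_sq_bounded_limit[OF FL2, where C=1])
    show "(\<lambda>n. complex_of_real (gauss_weight (Suc n) t)) \<longlonglongrightarrow> 1" for t
      using tendsto_of_real[OF gauss_weight_tendsto_1[of t], where 'a=complex] by simp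
  qed (auto simp: gauss_weight_bounds)
  then have lim: "(\<lambda>n. L2_sq (\<lambda>s. g n s - ?F s)) \<longlonglongrightarrow> 0" by simp
  have "(\<lambda>n. L2_sq (\<lambda>s. fourier_integral (g n) s - FP ?F s)) \<longlonglongrightarrow> 0"
  proof (rule ennreal_tendsto_add_0[OF lim lim, of 8 0])
    fix n
    have "L2_sq (\<lambda>s. fourier_integral (g n) s - FP ?F s) = L2_sq (\<lambda>s. FP (g n) s - FP ?F s)"
      using FP_eq_fourier_integral[OF gL2 gi, of n] unfolding ae_eq_def
      by (intro L2_sq_cong_AE) (auto elim: eventually_mono)
    then show "L2_sq (\<lambda>s. fourier_integral (g n) s - FP ?F s) \<le> 8 * L2_sq (\<lambda>s. g n s - ?F s) + 0 * L2_sq (\<lambda>s. g n s - ?F s)"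
      using L2_sq_FP_diff_le[OF gL2 FL2, of n] by simp
  qed auto
  then have "ae_eq (FP ?F) (\<lambda>u. f (- u))"
  proof (rule L2_sq_tendsto_pointwise_AE[rotated 3])
    show "AE u in lborel. (\<lambda>n. fourier_integral (g n) u) \<longlonglongrightarrow> f (- u)"
      unfolding g_def using gauss_convolution_tendsto[OF f b]
      by (subst fourier_integral_gauss_inversion) (auto simp: i)
    show "fourier_integral (g n) \<in> borel_measurable borel" for n using L2_measurable[OF gL2] by measurable
  qed auto
  moreover have "ae_eq (FP (FP f)) (FP ?F)"
    by (rule FP_cong[OF L2_FP[OF fL2] FL2 FP_eq_fourier_integral[OF fL2 i]])
  ultimately show ?thesis unfolding ae_eq_def by eventually_elim simp
qed

text \<open>Both sides depend continuously on f in mean square. The constant 128 is 2 * 8 * 8, from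
  the Lipschitz bound used twice inside the triangle inequality; the reflection is an
  isometry.\<close>

lemma FP_FP_closed:
  assumes f: "L2 f" and u: "\<And>n::nat. L2 (u n)" "\<And>n. ae_eq (FP (FP (u n))) (\<lambda>s. u n (- s))"
    and lim: "(\<lambda>n. L2_sq (\<lambda>t. u n t - f t)) \<longlonglongrightarrow> 0"
  shows "ae_eq (FP (FP f)) (\<lambda>s. f (- s))"
proof -
  have [measurable]: "f \<in> borel_measurable borel" "u n \<in> borel_measurable borel"
    "FP (FP f) \<in> borel_measurable borel" "FP (FP (u n)) \<in> borel_measurable borel" for n
    using f u by (auto simp: L2_measurable FP_measurable L2_FP)
  have "L2_sq (\<lambda>s. FP (FP f) s - f (- s)) = 0"
  proof (rule ennreal_limit_zeroI[OF _ lim lim, of _ 128 2])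
    fix n
    have "L2_sq (\<lambda>s. FP (FP f) s - f (- s)) \<le> 2 * L2_sq (\<lambda>s. FP (FP f) s - FP (FP (u n)) s) + 2 * L2_sq (\<lambda>s. FP (FP (u n)) s - f (- s))"
      by (rule L2_sq_triangle) auto
    also have "L2_sq (\<lambda>s. FP (FP f) s - FP (FP (u n)) s) \<le> 8 * L2_sq (\<lambda>s. FP f s - FP (u n) s)"
      by (intro L2_sq_FP_diff_le L2_FP f u)
    also have "L2_sq (\<lambda>s. FP f s - FP (u n) s) \<le> 8 * L2_sq (\<lambda>s. f s - u n s)"
      by (intro L2_sq_FP_diff_le f u)
    also have "L2_sq (\<lambda>s. f s - u n s) = L2_sq (\<lambda>s. u n s - f s)" by (rule L2_sq_minus_commute)
    also have "L2_sq (\<lambda>s. FP (FP (u n)) s - f (- s)) = L2_sq (\<lambda>s. u n (- s) - f (- s))"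
      using u(2)[of n] unfolding ae_eq_def by (intro L2_sq_cong_AE) (auto elim: eventually_mono)
    also have "\<dots> = L2_sq (\<lambda>s. u n s - f s)" by (rule L2_sq_reflect[of "\<lambda>s. u n s - f s"]) simp
    finally show "L2_sq (\<lambda>s. FP (FP f) s - f (- s)) \<le> 128 * L2_sq (\<lambda>s. u n s - f s) + 2 * L2_sq (\<lambda>s. u n s - f s)"
      by (simp add: mult.assoc[symmetric] mult_left_mono add_mono)
  qed auto
  then show ?thesis by (simp add: ae_eq_iff_L2_sq)
qed

lemma FP_FP_bounded_gaussian:
  assumes "\<phi> \<in> borel_measurable borel" "\<And>t. cmod (\<phi> t) \<le> C"
  shows "ae_eq (FP (FP (\<lambda>t. \<phi> t * gaussian t))) (\<lambda>s. \<phi> (- s) * gaussian (- s))"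
proof -
  \<comment> \<open>Measurability and boundedness are part of the induction predicate, because the
    linear and limit steps need the Gaussian multiples to lie in L2.\<close>
  define P where "P \<phi> \<longleftrightarrow> \<phi> \<in> borel_measurable borel \<and> (\<exists>C. \<forall>t. cmod (\<phi> t) \<le> C) \<and>
    ae_eq (FP (FP (\<lambda>t. \<phi> t * gaussian t))) (\<lambda>s. \<phi> (- s) * gaussian (- s))" for \<phi>
  have PL2: "L2 (\<lambda>t. \<phi> t * gaussian t)" if "P \<phi>" for \<phi>
  proof -
    obtain C where "\<And>t. cmod (\<phi> t) \<le> C" using \<open>P \<phi>\<close> by (auto simp: P_def)
    then show ?thesis using \<open>P \<phi>\<close> by (intro L2_bounded_mult[OF L2_gaussian]) (auto simp: P_def)
  qed
  have "P \<phi>"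
  proof (rule bounded_borel_induct[OF _ _ _ assms])
    fix \<psi> :: "real \<Rightarrow> real" and C
    assume c: "continuous_on UNIV \<psi>" and b: "\<And>t. \<bar>\<psi> t\<bar> \<le> C"
    have m[measurable]: "\<psi> \<in> borel_measurable borel" using c by (rule borel_measurable_continuous_onI)
    have C: "0 \<le> C" using b[of 0] by linarith
    have "ae_eq (FP (FP (\<lambda>t. complex_of_real (\<psi> t) * gaussian t))) (\<lambda>s. complex_of_real (\<psi> (- s)) * gaussian (- s))"
    proof (rule FP_FP_continuous[of "\<lambda>t. complex_of_real (\<psi> t) * gaussian t" C])
      show "continuous_on UNIV (\<lambda>t. complex_of_real (\<psi> t) * gaussian t)"
        unfolding gaussian_def gauss_weight_def by (intro continuous_intros c) auto
      show "cmod (complex_of_real (\<psi> t) * gaussian t) \<le> C" for t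
        using mult_mono[OF b[of t] gauss_weight_bounds(2)[of 1 t] C gauss_weight_bounds(1)] by (simp add: norm_mult cmod_gaussian)
      show "integrable lborel (\<lambda>t. complex_of_real (\<psi> t) * gaussian t)"
        using integrable_gauss_weight_mult[of 1 "\<lambda>t. complex_of_real (\<psi> t)" C] b by (simp add: gaussian_def mult.commute)
    qed
    then show "P (\<lambda>t. complex_of_real (\<psi> t))" unfolding P_def using b by auto
  next
    fix f g c assume f: "P f" and g: "P g"
    let ?f = "\<lambda>t. f t * gaussian t" let ?g = "\<lambda>t. g t * gaussian t"
    have L2s: "L2 ?f" "L2 ?g" using f g by (auto intro: PL2)
    have e: "(\<lambda>t. (f t + c * g t) * gaussian t) = (\<lambda>t. ?f t + c * ?g t)" by (simp add: algebra_simps)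
    have "ae_eq (FP (FP (\<lambda>t. ?f t + c * ?g t))) (FP (\<lambda>t. FP ?f t + c * FP ?g t))"
      by (intro FP_cong FP_add L2_FP L2_add L2_cmult L2s)
    moreover have "ae_eq (FP (\<lambda>t. FP ?f t + c * FP ?g t)) (\<lambda>t. FP (FP ?f) t + c * FP (FP ?g) t)"
      by (intro FP_add L2_FP L2s)
    moreover have "ae_eq (FP (FP ?f)) (\<lambda>s. f (- s) * gaussian (- s))" "ae_eq (FP (FP ?g)) (\<lambda>s. g (- s) * gaussian (- s))"
      using f g by (auto simp: P_def)
    ultimately have "ae_eq (FP (FP (\<lambda>t. (f t + c * g t) * gaussian t))) (\<lambda>s. (f (- s) + c * g (- s)) * gaussian (- s))"
      unfolding e unfolding ae_eq_def by eventually_elim (simp add: algebra_simps)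
    moreover obtain C D where "\<And>t. cmod (f t) \<le> C" "\<And>t. cmod (g t) \<le> D" using f g by (auto simp: P_def)
    then have "cmod (f t + c * g t) \<le> C + cmod c * D" for t
      by (intro norm_triangle_le add_mono) (auto simp: norm_mult mult_left_mono)
    ultimately show "P (\<lambda>t. f t + c * g t)" using f g unfolding P_def by auto
  next
    fix f :: "nat \<Rightarrow> real \<Rightarrow> complex" and g C
    assume f: "\<And>n. P (f n)" and b: "\<And>n t. cmod (f n t) \<le> C" and l: "\<And>t. (\<lambda>n. f n t) \<longlonglongrightarrow> g t"
    have m: "f n \<in> borel_measurable borel" for n using f by (simp add: P_def)
    then have mg: "g \<in> borel_measurable borel" by (rule borel_measurable_LIMSEQ_metric) (rule l)
    have bg: "cmod (g t) \<le> C" for t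
      by (rule LIMSEQ_le_const2[OF tendsto_norm[OF l]]) (use b in auto)
    have "ae_eq (FP (FP (\<lambda>t. g t * gaussian t))) (\<lambda>s. g (- s) * gaussian (- s))"
    proof (rule FP_FP_closed)
      show "L2 (\<lambda>t. g t * gaussian t)" by (rule L2_bounded_mult[OF L2_gaussian mg]) (use bg in auto)
      show "(\<lambda>n. L2_sq (\<lambda>t. f n t * gaussian t - g t * gaussian t)) \<longlonglongrightarrow> 0"
        by (rule L2_sq_bounded_limit[OF L2_gaussian m b l])
    qed (use f PL2 in \<open>auto simp: P_def\<close>)
    then show "P g" using mg bg by (auto simp: P_def)
  qed
  then show ?thesis by (simp add: P_def)
qed

text \<open>Bounded Gaussian multiples are dense and the identity is closed under mean square
  limits.\<close>

lemma FP_FP: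
  assumes f: "L2 f"
  shows "ae_eq (FP (FP f)) (\<lambda>s. f (- s))"
proof -
  obtain \<phi> where \<phi>: "\<And>n::nat. \<phi> n \<in> borel_measurable borel" "\<And>n t. cmod (\<phi> n t) \<le> real n"
    "(\<lambda>n. L2_sq (\<lambda>t. \<phi> n t * gaussian t - f t)) \<longlonglongrightarrow> 0"
    by (rule L2_approx_gaussian[OF f]) (rule that)
  show ?thesis
  proof (rule FP_FP_closed[OF f _ _ \<phi>(3)])
    show "L2 (\<lambda>t. \<phi> n t * gaussian t)" for n
      by (rule L2_bounded_mult[OF L2_gaussian \<phi>(1)]) (use \<phi>(2) in auto)
    show "ae_eq (FP (FP (\<lambda>t. \<phi> n t * gaussian t))) (\<lambda>s. \<phi> n (- s) * gaussian (- s))" for n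
      by (rule FP_FP_bounded_gaussian[OF \<phi>(1,2)])
  qed
qed

text \<open>By \<open>FP_FP\<close>, the transform of the reflected g is a preimage of g, so the
  choice in \<open>FP_inv\<close> has a witness.\<close>

lemma FP_inv_properties:
  assumes g: "L2 g"
  shows L2_FP_inv: "L2 (FP_inv g)" and FP_FP_inv: "ae_eq (FP (FP_inv g)) g"
proof -
  have "L2 (\<lambda>t. g (- t))" using L2_affine[OF g, of "-1" 0] by simp
  then have "L2 (FP (\<lambda>t. g (- t))) \<and> ae_eq (FP (FP (\<lambda>t. g (- t)))) g"
    using L2_FP FP_FP[of "\<lambda>t. g (- t)"] by simp
  then have "L2 (FP_inv g) \<and> ae_eq (FP (FP_inv g)) g"
    unfolding FP_inv_def by (rule someI[where P="\<lambda>f. L2 f \<and> ae_eq (FP f) g"])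
  then show "L2 (FP_inv g)" "ae_eq (FP (FP_inv g)) g" by auto
qed

section \<open>Explicit forms of \<open>T_hat\<close> and \<open>D_hat\<close>\<close>

lemma T_hat_eq:
  assumes g: "L2 g"
  shows "ae_eq (T_hat g) (\<lambda>s. exp (- \<i> * complex_of_real s) * g s)"
  using FP_transl[OF L2_FP_inv[OF g]] FP_FP_inv[OF g] unfolding T_hat_def ae_eq_def
  by eventually_elim simp

lemma D_hat_eq:
  assumes g: "L2 g"
  shows "ae_eq (D_hat g) (\<lambda>s. complex_of_real (1 / sqrt 2) * g (s / 2))"
proof -
  \<comment> \<open>The inversion identity holds only a.e., so it has to be transported along s / 2,
    which preserves null sets.\<close>
  have "ae_eq (\<lambda>s. FP (FP_inv g) (0 + 1/2 * s)) (\<lambda>s. g (0 + 1/2 * s))"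
    by (intro ae_eq_affine FP_FP_inv FP_measurable L2_FP_inv L2_measurable g) simp
  then show ?thesis
    using FP_dil[OF L2_FP_inv[OF g]] unfolding D_hat_def ae_eq_def
    by (auto elim!: eventually_elim2)
qed

lemma L2_T_hat: "L2 g \<Longrightarrow> L2 (T_hat g)"
  unfolding T_hat_def by (intro L2_FP L2_transl L2_FP_inv)

lemma L2_D_hat: "L2 g \<Longrightarrow> L2 (D_hat g)"
  unfolding D_hat_def by (intro L2_FP L2_dil L2_FP_inv)

section \<open>The commutant\<close>

lemma ae_eq_trans [trans]:
  assumes "ae_eq f g" "ae_eq g h"
  shows "ae_eq f h"
  using assms unfolding ae_eq_def by eventually_elim simp

lemma ae_eq_sym: "ae_eq f g \<Longrightarrow> ae_eq g f"
  by (simp add: ae_eq_def eq_commute)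

lemma L2_sq_cong: "ae_eq f g \<Longrightarrow> L2_sq (\<lambda>t. f t - h t) = L2_sq (\<lambda>t. g t - h t)"
  unfolding ae_eq_def by (intro L2_sq_cong_AE) (auto elim: eventually_mono)

text \<open>The bound holds everywhere rather than a.e., as in \<open>bounded_borel_induct\<close>,
  while commutation is required only modulo null sets.\<close>

definition multiplier :: "((real \<Rightarrow> complex) \<Rightarrow> (real \<Rightarrow> complex)) \<Rightarrow> (real \<Rightarrow> complex) \<Rightarrow> bool" where
  "multiplier A \<phi> \<longleftrightarrow> \<phi> \<in> borel_measurable borel \<and> (\<exists>C. \<forall>t. cmod (\<phi> t) \<le> C) \<and>
     (\<forall>f. L2 f \<longrightarrow> ae_eq (A (\<lambda>t. \<phi> t * f t)) (\<lambda>t. \<phi> t * A f t))"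

lemma multiplier_measurable: "multiplier A \<phi> \<Longrightarrow> \<phi> \<in> borel_measurable borel"
  by (simp add: multiplier_def)

lemma multiplierD: "multiplier A \<phi> \<Longrightarrow> L2 f \<Longrightarrow> ae_eq (A (\<lambda>t. \<phi> t * f t)) (\<lambda>t. \<phi> t * A f t)"
  by (simp add: multiplier_def)

lemma multiplier_bounded: "multiplier A \<phi> \<Longrightarrow> \<exists>C. \<forall>t. cmod (\<phi> t) \<le> C"
  by (simp add: multiplier_def)

lemma L2_multiplier: "multiplier A \<phi> \<Longrightarrow> L2 f \<Longrightarrow> L2 (\<lambda>t. \<phi> t * f t)"
  using multiplier_bounded[of A \<phi>] by (auto intro: L2_bounded_mult multiplier_measurable)

lemma bounded_op_L2_sq:
  assumes "bounded_op A"
  obtains C where "\<And>f. L2 f \<Longrightarrow> L2_sq (A f) \<le> ennreal (C\<^sup>2) * L2_sq f"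
proof -
  obtain C where C: "\<And>f. L2 f \<Longrightarrow> L2_norm (A f) \<le> C * L2_norm f"
    using assms by (auto simp: bounded_op_def)
  have "L2_sq (A f) \<le> ennreal (C\<^sup>2) * L2_sq f" if "L2 f" for f
  proof -
    have "L2 (A f)" using assms that by (simp add: bounded_op_def)
    \<comment> \<open>Nonnegativity of the smaller side permits squaring, whatever the sign of
      C.\<close>
    have "0 \<le> L2_norm (A f)" by (simp add: L2_norm_def)
    then have "(L2_norm (A f))\<^sup>2 \<le> C\<^sup>2 * (L2_norm f)\<^sup>2"
      using power_mono[OF C[OF that], of 2] by (simp add: power_mult_distrib)
    then show ?thesis
      using L2_sq_eq_L2_norm[OF that] L2_sq_eq_L2_norm[OF \<open>L2 (A f)\<close>] by (simp add: ennreal_mult[symmetric] ennreal_leI)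
  qed
  then show thesis using that by blast
qed

section \<open>The algebra of multipliers of a bounded operator\<close>

locale bounded_operator =
  fixes A :: "(real \<Rightarrow> complex) \<Rightarrow> (real \<Rightarrow> complex)"
  assumes A: "bounded_op A"
begin

lemma L2_op: "L2 f \<Longrightarrow> L2 (A f)"
  using A by (simp add: bounded_op_def)

lemma op_measurable: "L2 f \<Longrightarrow> A f \<in> borel_measurable borel"
  by (rule L2_measurable[OF L2_op])

lemma op_cong: "L2 f \<Longrightarrow> L2 g \<Longrightarrow> ae_eq f g \<Longrightarrow> ae_eq (A f) (A g)"
  using A by (simp add: bounded_op_def)

lemma op_add: "L2 f \<Longrightarrow> L2 g \<Longrightarrow> ae_eq (A (\<lambda>t. f t + a * g t)) (\<lambda>t. A f t + a * A g t)"
  using A by (simp add: bounded_op_def)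

lemma op_lipschitz: "\<exists>K<\<infinity>. \<forall>f g. L2 f \<longrightarrow> L2 g \<longrightarrow> L2_sq (\<lambda>t. A f t - A g t) \<le> K * L2_sq (\<lambda>t. f t - g t)"
proof -
  obtain C where C: "\<And>f. L2 f \<Longrightarrow> L2_sq (A f) \<le> ennreal (C\<^sup>2) * L2_sq f" by (rule bounded_op_L2_sq[OF A]) (rule that)
  have "L2_sq (\<lambda>t. A f t - A g t) \<le> ennreal (C\<^sup>2) * L2_sq (\<lambda>t. f t - g t)" if "L2 f" "L2 g" for f g
  proof -
    have "L2_sq (\<lambda>t. A f t - A g t) = L2_sq (A (\<lambda>t. f t + (-1) * g t))"
      using op_add[OF that, of "-1"] unfolding ae_eq_def by (intro L2_sq_cong_AE) (auto elim!: eventually_mono)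
    also have "\<dots> \<le> ennreal (C\<^sup>2) * L2_sq (\<lambda>t. f t + (-1) * g t)"
      by (intro C L2_add L2_cmult that)
    finally show ?thesis by simp
  qed
  then show ?thesis by (intro exI[of _ "ennreal (C\<^sup>2)"]) auto
qed

text \<open>Boundedness carries u n -> f over to the images under \<open>A\<close>, and mean square
  limits are unique a.e.\<close>

lemma op_limit_eq:
  assumes f: "L2 f" and u: "\<And>n::nat. L2 (u n)" and lim: "(\<lambda>n. L2_sq (\<lambda>t. u n t - f t)) \<longlonglongrightarrow> 0"
    and v: "v \<in> borel_measurable borel" and limA: "(\<lambda>n. L2_sq (\<lambda>t. A (u n) t - v t)) \<longlonglongrightarrow> 0"
  shows "ae_eq (A f) v"
proof (rule L2_sq_tendsto_unique_AE[OF _ _ v _ limA])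
  obtain K where K: "K < \<infinity>" "\<And>f g. L2 f \<Longrightarrow> L2 g \<Longrightarrow> L2_sq (\<lambda>t. A f t - A g t) \<le> K * L2_sq (\<lambda>t. f t - g t)"
    using op_lipschitz by auto
  show "(\<lambda>n. L2_sq (\<lambda>t. A (u n) t - A f t)) \<longlonglongrightarrow> 0"
    by (rule ennreal_tendsto_add_0[OF lim lim K(1), of 0]) (use K(2)[OF u f] in auto)
qed (use f u op_measurable in auto)

lemma multiplier_one: "multiplier A (\<lambda>t. 1)"
  by (auto simp: multiplier_def ae_eq_def)

lemma multiplier_add:
  assumes "multiplier A \<phi>" "multiplier A \<psi>"
  shows "multiplier A (\<lambda>t. \<phi> t + c * \<psi> t)"
proof -
  have "ae_eq (A (\<lambda>t. (\<phi> t + c * \<psi> t) * f t)) (\<lambda>t. (\<phi> t + c * \<psi> t) * A f t)" if f: "L2 f" for f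
  proof -
    have e: "(\<lambda>t. (\<phi> t + c * \<psi> t) * f t) = (\<lambda>t. \<phi> t * f t + c * (\<psi> t * f t))" by (simp add: algebra_simps)
    have "ae_eq (A (\<lambda>t. \<phi> t * f t + c * (\<psi> t * f t))) (\<lambda>t. A (\<lambda>t. \<phi> t * f t) t + c * A (\<lambda>t. \<psi> t * f t) t)"
      by (intro op_add L2_multiplier[OF assms(1)] L2_multiplier[OF assms(2)] f)
    then show ?thesis
      unfolding e using multiplierD[OF assms(1) f] multiplierD[OF assms(2) f]
      unfolding ae_eq_def by eventually_elim (simp add: algebra_simps)
  qed
  moreover obtain C D where "\<And>t. cmod (\<phi> t) \<le> C" "\<And>t. cmod (\<psi> t) \<le> D"
    using assms[THEN multiplier_bounded] by auto
  then have "cmod (\<phi> t + c * \<psi> t) \<le> C + cmod c * D" for t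
    by (intro norm_triangle_le add_mono) (auto simp: norm_mult mult_left_mono)
  ultimately show ?thesis using assms unfolding multiplier_def by auto
qed

lemma multiplier_cmult: "multiplier A \<phi> \<Longrightarrow> multiplier A (\<lambda>t. c * \<phi> t)"
  using multiplier_add[of \<phi> \<phi> "c - 1"] by (simp add: algebra_simps)

lemma multiplier_const: "multiplier A (\<lambda>t. c)"
  using multiplier_cmult[OF multiplier_one, of c] by simp

lemma multiplier_mult:
  assumes "multiplier A \<phi>" "multiplier A \<psi>"
  shows "multiplier A (\<lambda>t. \<phi> t * \<psi> t)"
proof -
  have "ae_eq (A (\<lambda>t. (\<phi> t * \<psi> t) * f t)) (\<lambda>t. (\<phi> t * \<psi> t) * A f t)" if f: "L2 f" for f
    using multiplierD[OF assms(1) L2_multiplier[OF assms(2) f]] multiplierD[OF assms(2) f]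
    unfolding ae_eq_def by (auto simp: mult.assoc elim!: eventually_elim2)
  moreover obtain C D where CD: "\<And>t. cmod (\<phi> t) \<le> C" "\<And>t. cmod (\<psi> t) \<le> D"
    using assms[THEN multiplier_bounded] by auto
  then have "cmod (\<phi> t * \<psi> t) \<le> C * D" for t
    unfolding norm_mult by (intro mult_mono) (auto intro: order_trans[OF norm_ge_zero CD(1)])
  ultimately show ?thesis using assms unfolding multiplier_def by auto
qed

text \<open>For unimodular \<phi> the conjugate is the inverse, so applying the multiplier property
  of \<phi> to cnj \<phi> * f and cancelling gives the claim.\<close>

lemma multiplier_cnj:
  assumes \<phi>: "multiplier A \<phi>" and u: "\<And>t. cmod (\<phi> t) = 1"
  shows "multiplier A (\<lambda>t. cnj (\<phi> t))"
proof -
  have [measurable]: "\<phi> \<in> borel_measurable borel" using \<phi> by (rule multiplier_measurable)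
  have one: "\<phi> t * cnj (\<phi> t) = 1" for t
    using complex_norm_square[of "\<phi> t"] u[of t] by simp
  have inv: "\<phi> t * (cnj (\<phi> t) * x) = x" "cnj (\<phi> t) * (\<phi> t * x) = x" for t x
    using one[of t] by (metis mult.assoc mult.commute mult_1_left)+
  have "ae_eq (A (\<lambda>t. cnj (\<phi> t) * f t)) (\<lambda>t. cnj (\<phi> t) * A f t)" if f: "L2 f" for f
  proof -
    have "L2 (\<lambda>t. cnj (\<phi> t) * f t)"
      by (rule L2_bounded_mult[OF f, where C=1]) (auto simp: u)
    from multiplierD[OF \<phi> this] show ?thesis
      unfolding ae_eq_def inv by eventually_elim (simp add: inv)
  qed
  then show ?thesis unfolding multiplier_def using u by (auto intro!: exI[of _ 1])
qed

text \<open>Multiplication by \<phi> n converges strongly by dominated convergence. It is applied to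
  f inside \<open>A\<close>, where boundedness of \<open>A\<close> preserves the limit, and to
  \<open>A f\<close> outside.\<close>

lemma multiplier_limit:
  assumes m: "\<And>n::nat. multiplier A (\<phi> n)" and b: "\<And>n t. cmod (\<phi> n t) \<le> C"
    and l: "\<And>t. (\<lambda>n. \<phi> n t) \<longlonglongrightarrow> \<psi> t"
  shows "multiplier A \<psi>"
proof -
  have \<phi>m: "\<phi> n \<in> borel_measurable borel" for n using m by (rule multiplier_measurable)
  then have \<psi>m[measurable]: "\<psi> \<in> borel_measurable borel" by (rule borel_measurable_LIMSEQ_metric) (rule l)
  have b\<psi>: "cmod (\<psi> t) \<le> C" for t by (rule LIMSEQ_le_const2[OF tendsto_norm[OF l]]) (use b in auto)
  have "ae_eq (A (\<lambda>t. \<psi> t * f t)) (\<lambda>t. \<psi> t * A f t)" if f: "L2 f" for f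
  proof (rule op_limit_eq)
    have [measurable]: "A f \<in> borel_measurable borel" using f by (rule op_measurable)
    show "L2 (\<lambda>t. \<psi> t * f t)" by (rule L2_bounded_mult[OF f \<psi>m]) (use b\<psi> in auto)
    show "L2 (\<lambda>t. \<phi> n t * f t)" for n by (rule L2_multiplier[OF m f])
    show "(\<lambda>n. L2_sq (\<lambda>t. \<phi> n t * f t - \<psi> t * f t)) \<longlonglongrightarrow> 0" by (rule L2_sq_bounded_limit[OF f \<phi>m b l])
    show "(\<lambda>t. \<psi> t * A f t) \<in> borel_measurable borel" by measurable
    show "(\<lambda>n. L2_sq (\<lambda>t. A (\<lambda>t. \<phi> n t * f t) t - \<psi> t * A f t)) \<longlonglongrightarrow> 0"
      using L2_sq_bounded_limit[OF L2_op[OF f] \<phi>m b l] by (simp add: L2_sq_cong[OF multiplierD[OF m f]])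
  qed
  then show ?thesis unfolding multiplier_def using \<psi>m b\<psi> by auto
qed

end

section \<open>Multipliers of an operator commuting with \<open>D_hat\<close> and
  \<open>T_hat\<close>\<close>

locale commuting_operator = bounded_operator +
  assumes comm_D: "commutes A D_hat" and comm_T: "commutes A T_hat"
begin

lemma multiplier_exp: "multiplier A (\<lambda>s. exp (- \<i> * complex_of_real s))"
proof -
  have "ae_eq (A (\<lambda>s. exp (- \<i> * complex_of_real s) * f s)) (\<lambda>s. exp (- \<i> * complex_of_real s) * A f s)" if f: "L2 f" for f
  proof -
    have "L2 (\<lambda>s. exp (- \<i> * complex_of_real s) * f s)" by (rule L2_bounded_mult[OF f, where C=1]) auto
    then have "ae_eq (A (\<lambda>s. exp (- \<i> * complex_of_real s) * f s)) (A (T_hat f))"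
      by (intro op_cong L2_T_hat ae_eq_sym[OF T_hat_eq] f)
    also have "ae_eq (A (T_hat f)) (T_hat (A f))" using comm_T f by (simp add: commutes_def)
    also have "ae_eq (T_hat (A f)) (\<lambda>s. exp (- \<i> * complex_of_real s) * A f s)" by (intro T_hat_eq L2_op f)
    finally show ?thesis .
  qed
  then show ?thesis unfolding multiplier_def by (auto intro!: exI[of _ 1])
qed

text \<open>Conjugating multiplication by \<phi> with \<open>D_hat\<close> gives multiplication by
  \<phi> (s / 2), and \<open>A\<close> commutes with every factor of this conjugation.\<close>

lemma multiplier_halve:
  assumes \<phi>: "multiplier A \<phi>"
  shows "multiplier A (\<lambda>s. \<phi> (s / 2))"
proof -
  have [measurable]: "\<phi> \<in> borel_measurable borel" using \<phi> by (rule multiplier_measurable)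
  have "ae_eq (A (\<lambda>s. \<phi> (s / 2) * f s)) (\<lambda>s. \<phi> (s / 2) * A f s)" if f: "L2 f" for f
  proof -
    let ?c = "complex_of_real (1 / sqrt 2)"
    \<comment> \<open>On the frequency side \<open>D_hat\<close> halves the argument, so the formula
      of \<open>dil\<close> produces a preimage of f under it.\<close>
    define g where "g = dil f"
    have g: "L2 g" unfolding g_def by (rule L2_dil[OF f])
    have \<phi>g: "L2 (\<lambda>t. \<phi> t * g t)" by (rule L2_multiplier[OF \<phi> g])
    have fg: "?c * g (s / 2) = f s" for s by (simp add: g_def dil_def)
    have "?c * (\<phi> (s / 2) * g (s / 2)) = \<phi> (s / 2) * f s" for s using fg[of s] by (simp add: mult_ac)
    then have Dg: "ae_eq (D_hat g) f" "ae_eq (D_hat (\<lambda>t. \<phi> t * g t)) (\<lambda>s. \<phi> (s / 2) * f s)"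
      using D_hat_eq[OF g] D_hat_eq[OF \<phi>g] fg by simp_all
    have \<phi>f: "L2 (\<lambda>s. \<phi> (s / 2) * f s)"
    proof -
      obtain C where "\<And>t. cmod (\<phi> t) \<le> C" using multiplier_bounded[OF \<phi>] by auto
      then show ?thesis by (intro L2_bounded_mult[OF f, where C=C]) auto
    qed
    have DA: "ae_eq (\<lambda>s. ?c * A u (s / 2)) (A (D_hat u))" if "L2 u" for u
      using ae_eq_sym[OF D_hat_eq[OF L2_op[OF that]]] comm_D that
      unfolding commutes_def by (blast intro: ae_eq_trans ae_eq_sym)
    have "ae_eq (\<lambda>s. A (\<lambda>t. \<phi> t * g t) (0 + 1/2 * s)) (\<lambda>s. (\<lambda>t. \<phi> t * A g t) (0 + 1/2 * s))"
      using op_measurable[OF g] by (intro ae_eq_affine multiplierD[OF \<phi> g] op_measurable \<phi>g) auto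
    then have 1: "ae_eq (\<lambda>s. ?c * A (\<lambda>t. \<phi> t * g t) (s / 2)) (\<lambda>s. \<phi> (s / 2) * (?c * A g (s / 2)))"
      unfolding ae_eq_def by eventually_elim simp
    have 2: "ae_eq (A (D_hat g)) (A f)" by (intro op_cong L2_D_hat Dg g f)
    have 3: "ae_eq (A (D_hat (\<lambda>t. \<phi> t * g t))) (A (\<lambda>s. \<phi> (s / 2) * f s))"
      by (intro op_cong L2_D_hat Dg \<phi>g \<phi>f)
    show ?thesis
      using 1 2 3 DA[OF g] DA[OF \<phi>g] unfolding ae_eq_def by eventually_elim metis
  qed
  then show ?thesis using \<phi> unfolding multiplier_def by auto
qed

lemma multiplier_exp_dyadic: "multiplier A (\<lambda>s. exp (- \<i> * complex_of_real (s / 2 ^ n)))"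
proof (induction n)
  case 0
  then show ?case using multiplier_exp by simp
next
  case (Suc n)
  from multiplier_halve[OF this] show ?case by (simp add: mult.commute)
qed

text \<open>A bounded substitute for the unbounded function s: a trigonometric polynomial in the
  available exponentials that tends to s pointwise.\<close>

definition dyadic_sin :: "nat \<Rightarrow> real \<Rightarrow> real" where
  "dyadic_sin n s = 2 ^ n * sin (s / 2 ^ n)"

lemma multiplier_dyadic_sin: "multiplier A (\<lambda>s. complex_of_real (dyadic_sin n s))"
proof -
  let ?e = "\<lambda>s. exp (- \<i> * complex_of_real (s / 2 ^ n))"
  have "multiplier A (\<lambda>s. cnj (?e s))" by (rule multiplier_cnj[OF multiplier_exp_dyadic]) simp
  then have "multiplier A (\<lambda>s. (2 ^ n / (2 * \<i>)) * (cnj (?e s) + (-1) * ?e s))"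
    by (intro multiplier_cmult multiplier_add multiplier_exp_dyadic)
  moreover have "(2 ^ n / (2 * \<i>)) * (cnj (?e s) + (-1) * ?e s) = complex_of_real (dyadic_sin n s)" for s
    by (simp add: dyadic_sin_def sin_of_real[symmetric] sin_exp_eq exp_cnj)
  ultimately show ?thesis by simp
qed

lemma multiplier_polynomial_dyadic_sin:
  "real_polynomial_function p \<Longrightarrow> multiplier A (\<lambda>s. complex_of_real (p (dyadic_sin n s)))"
proof (induction p rule: real_polynomial_function.induct)
  case (linear p)
  \<comment> \<open>The base case supplies an abstract bounded linear map; on the reals it is
    multiplication by its value at 1.\<close>
  then have "p = (\<lambda>x. p 1 * x)"
  proof (intro ext)
    fix x
    show "p x = p 1 * x"
      using linear_scale[OF bounded_linear.linear[OF linear], of x 1] by (simp add: mult.commute)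
  qed
  then obtain c where "p = (\<lambda>x. c * x)" by (rule that)
  then show ?case using multiplier_cmult[OF multiplier_dyadic_sin, of "complex_of_real c"] by simp
next
  case (const c)
  then show ?case by (rule multiplier_const)
next
  case (add f g)
  then show ?case using multiplier_add[of _ _ 1] by simp
next
  case (mult f g)
  then show ?case using multiplier_mult by simp
qed

text \<open>This is the difference quotient at 0 of h -> sin (s * h), with derivative s, taken along
  h = 2^-n.\<close>

lemma dyadic_sin_tendsto: "(\<lambda>n. dyadic_sin n s) \<longlonglongrightarrow> s"
proof -
  have "((\<lambda>h. sin (s * h)) has_real_derivative s) (at 0)"
    by (auto intro!: derivative_eq_intros)
  then have "((\<lambda>h. sin (s * h) / h) \<longlongrightarrow> s) (at 0)" by (simp add: has_field_derivative_iff)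
  moreover have "filterlim (\<lambda>n. (1/2)^n :: real) (at 0) sequentially"
    by (intro filterlim_atI LIMSEQ_realpow_zero) auto
  ultimately have "(\<lambda>n. sin (s * (1/2)^n) / (1/2)^n) \<longlonglongrightarrow> s" by (rule filterlim_compose)
  then show ?thesis by (simp add: dyadic_sin_def power_one_over field_simps)
qed

text \<open>Two limits are nested: for fixed n, polynomials approximate g uniformly on the compact
  range of \<open>dyadic_sin n\<close>; then n grows and continuity of g applies.\<close>

lemma multiplier_continuous:
  fixes g :: "real \<Rightarrow> real"
  assumes c: "continuous_on UNIV g" and b: "\<And>t. \<bar>g t\<bar> \<le> C"
  shows "multiplier A (\<lambda>s. complex_of_real (g s))"
proof (rule multiplier_limit)
  show "cmod (complex_of_real (g (dyadic_sin n t))) \<le> C" for n t using b by simp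
  show "(\<lambda>n. complex_of_real (g (dyadic_sin n t))) \<longlonglongrightarrow> complex_of_real (g t)" for t
    using c by (intro tendsto_of_real isCont_tendsto_compose[OF _ dyadic_sin_tendsto]) (simp add: continuous_on_eq_continuous_at)
  show "multiplier A (\<lambda>s. complex_of_real (g (dyadic_sin n s)))" for n
  proof -
    have "\<exists>p. real_polynomial_function p \<and> (\<forall>x\<in>{-(2^n)..2^n}. \<bar>g x - p x\<bar> < 1 / Suc m)" for m
      by (rule Stone_Weierstrass_real_polynomial_function[of "{-(2^n)..2^n}" g "1 / Suc m"])
         (auto intro: continuous_on_subset[OF c])
    then obtain p where p: "\<And>m. real_polynomial_function (p m)"
      "\<And>m x. x \<in> {-(2^n)..2^n} \<Longrightarrow> \<bar>g x - p m x\<bar> < 1 / Suc m" by metis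
    have S: "dyadic_sin n s \<in> {-(2^n)..2^n}" for s
      using mult_left_mono[OF sin_le_one[of "s / 2^n"], of "2^n"] mult_left_mono[OF sin_ge_minus_one[of "s / 2^n"], of "2^n"]
      by (simp add: dyadic_sin_def)
    show ?thesis
    proof (rule multiplier_limit)
      show "multiplier A (\<lambda>s. complex_of_real (p m (dyadic_sin n s)))" for m
        by (rule multiplier_polynomial_dyadic_sin[OF p(1)])
      show "cmod (complex_of_real (p m (dyadic_sin n t))) \<le> C + 1" for m t
      proof -
        \<comment> \<open>The approximation error is below 1 for all m, hence the uniform bound C +
          1.\<close>
        have "1 / real (Suc m) \<le> 1" by simp
        then show ?thesis unfolding norm_of_real using p(2)[OF S, of t m] b[of "dyadic_sin n t"] by linarith
      qed
      show "(\<lambda>m. complex_of_real (p m (dyadic_sin n t))) \<longlonglongrightarrow> complex_of_real (g (dyadic_sin n t))" for t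
      proof (rule tendsto_of_real, rule LIM_zero_cancel, rule Lim_null_comparison)
        show "(\<lambda>m. 1 / real (Suc m)) \<longlonglongrightarrow> 0" using LIMSEQ_Suc[OF lim_const_over_n[of 1]] .
        show "\<forall>\<^sub>F m in sequentially. norm (p m (dyadic_sin n t) - g (dyadic_sin n t)) \<le> 1 / real (Suc m)"
          using p(2)[OF S, of t] by (intro always_eventually allI) (simp add: abs_minus_commute less_imp_le)
      qed
    qed
  qed
qed

lemma multiplier_bounded_borel:
  assumes "\<phi> \<in> borel_measurable borel" "\<And>t. cmod (\<phi> t) \<le> C"
  shows "multiplier A \<phi>"
  by (rule bounded_borel_induct[OF multiplier_continuous multiplier_add multiplier_limit assms])

section \<open>The symbol of \<open>A\<close>\<close>

definition symbol :: "real \<Rightarrow> complex" where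
  "symbol s = A gaussian s / gaussian s"

lemma symbol_gaussian: "symbol s * gaussian s = A gaussian s"
  by (simp add: symbol_def gaussian_nonzero)

lemma symbol_measurable [measurable]: "symbol \<in> borel_measurable borel"
  using op_measurable[OF L2_gaussian] unfolding symbol_def[abs_def] by measurable

text \<open>Every bounded Borel \<phi> is a multiplier, so \<open>A\<close> sends \<phi> times the
  Gaussian to \<phi> times \<open>A gaussian\<close>; this single value thus determines the
  symbol.\<close>

lemma op_bounded_gaussian:
  assumes "\<phi> \<in> borel_measurable borel" "\<And>t. cmod (\<phi> t) \<le> C"
  shows "ae_eq (A (\<lambda>t. \<phi> t * gaussian t)) (\<lambda>t. symbol t * (\<phi> t * gaussian t))"
  using multiplierD[OF multiplier_bounded_borel[OF assms] L2_gaussian]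
  by (simp add: symbol_gaussian[symmetric] mult_ac)

text \<open>The norm bound of \<open>A\<close> is tested on the Gaussian cut down to the set where
  the symbol is large; the Gaussian factor keeps the test function in L2 even if that set has
  infinite measure.\<close>

lemma symbol_bounded: "\<exists>C. AE s in lborel. cmod (symbol s) \<le> C"
proof -
  obtain C where C: "\<And>f. L2 f \<Longrightarrow> L2_sq (A f) \<le> ennreal (C\<^sup>2) * L2_sq f" by (rule bounded_op_L2_sq[OF A]) (rule that)
  \<comment> \<open>Since (|C| + 1)^2 > C^2 for either sign of C, the test function supported on B
    must have norm 0, which makes B a null set.\<close>
  define B where "B = {s. cmod (symbol s) > \<bar>C\<bar> + 1}"
  have [measurable]: "B \<in> sets borel" unfolding B_def by measurable
  let ?f = "\<lambda>t. complex_of_real (indicator B t) * gaussian t"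
  have f: "L2 ?f" by (rule L2_bounded_mult[OF L2_gaussian, where C=1]) (auto simp: indicator_def)
  obtain r where r: "0 \<le> r" "L2_sq ?f = ennreal r" using L2_sq_eq_L2_norm[OF f] by (metis zero_le_power2)
  have "ennreal ((\<bar>C\<bar> + 1)\<^sup>2) * L2_sq ?f = L2_sq (\<lambda>t. complex_of_real (\<bar>C\<bar> + 1) * ?f t)"
    by (subst L2_sq_scale) (auto simp: norm_of_real simp del: of_real_add)
  also have "\<dots> \<le> L2_sq (\<lambda>t. symbol t * ?f t)"
    by (rule L2_sq_mono) (auto simp: norm_mult B_def indicator_def simp del: of_real_add intro!: mult_right_mono)
  also have "\<dots> = L2_sq (A ?f)"
    using op_bounded_gaussian[of "\<lambda>t. complex_of_real (indicator B t)" 1] unfolding ae_eq_def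
    by (intro L2_sq_cong_AE) (auto elim!: eventually_mono simp: indicator_def)
  also have "\<dots> \<le> ennreal (C\<^sup>2) * L2_sq ?f" by (rule C[OF f])
  finally have "(\<bar>C\<bar> + 1)\<^sup>2 * r \<le> C\<^sup>2 * r" using r by (simp add: ennreal_mult[symmetric] del: ennreal_mult')
  moreover have "C\<^sup>2 < (\<bar>C\<bar> + 1)\<^sup>2" by (simp add: power2_eq_square algebra_simps)
  ultimately have "r = 0" using r(1) by (smt (verit) mult_strict_right_mono)
  then have "AE t in lborel. ?f t = 0" using r by (subst L2_sq_eq_0_iff[symmetric]) auto
  then have "AE t in lborel. cmod (symbol t) \<le> \<bar>C\<bar> + 1"
    by eventually_elim (auto simp: gaussian_nonzero B_def indicator_def split: if_splits)
  then show ?thesis by blast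
qed

text \<open>The formula holds on the dense class of bounded Gaussian multiples, and the essential
  bound on the symbol makes the right-hand side continuous in mean square.\<close>

lemma op_eq_mult_symbol:
  assumes f: "L2 f"
  shows "ae_eq (A f) (mult_op symbol f)"
proof -
  have [measurable]: "f \<in> borel_measurable borel" using f by (rule L2_measurable)
  obtain C where C: "AE s in lborel. cmod (symbol s) \<le> C" using symbol_bounded by blast
  obtain \<phi> where \<phi>: "\<And>n::nat. \<phi> n \<in> borel_measurable borel" "\<And>n t. cmod (\<phi> n t) \<le> real n"
    "(\<lambda>n. L2_sq (\<lambda>t. \<phi> n t * gaussian t - f t)) \<longlonglongrightarrow> 0"
    by (rule L2_approx_gaussian[OF f]) (rule that)
  have [measurable]: "\<phi> n \<in> borel_measurable borel" for n by (rule \<phi>(1))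
  have "ae_eq (A f) (\<lambda>t. symbol t * f t)"
  proof (rule op_limit_eq[OF f _ \<phi>(3)])
    show "L2 (\<lambda>t. \<phi> n t * gaussian t)" for n
      by (rule L2_bounded_mult[OF L2_gaussian \<phi>(1)]) (use \<phi>(2) in auto)
    show "(\<lambda>t. symbol t * f t) \<in> borel_measurable borel" by measurable
    show "(\<lambda>n. L2_sq (\<lambda>t. A (\<lambda>t. \<phi> n t * gaussian t) t - symbol t * f t)) \<longlonglongrightarrow> 0"
    proof (rule ennreal_tendsto_add_0[OF \<phi>(3) \<phi>(3), of "ennreal (C\<^sup>2)" 0])
      fix n
      have "L2_sq (\<lambda>t. A (\<lambda>t. \<phi> n t * gaussian t) t - symbol t * f t) = L2_sq (\<lambda>t. symbol t * (\<phi> n t * gaussian t) - symbol t * f t)"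
        by (rule L2_sq_cong[OF op_bounded_gaussian[OF \<phi>(1,2)]])
      also have "\<dots> \<le> L2_sq (\<lambda>t. complex_of_real C * (\<phi> n t * gaussian t - f t))"
      proof (rule L2_sq_mono_AE)
        show "AE t in lborel. cmod (symbol t * (\<phi> n t * gaussian t) - symbol t * f t) \<le> cmod (complex_of_real C * (\<phi> n t * gaussian t - f t))"
          using C by eventually_elim (auto simp: norm_mult right_diff_distrib[symmetric] intro!: mult_right_mono)
      qed
      also have "\<dots> = ennreal (C\<^sup>2) * L2_sq (\<lambda>t. \<phi> n t * gaussian t - f t)" by (subst L2_sq_scale) auto
      finally show "L2_sq (\<lambda>t. A (\<lambda>t. \<phi> n t * gaussian t) t - symbol t * f t) \<le>
        ennreal (C\<^sup>2) * L2_sq (\<lambda>t. \<phi> n t * gaussian t - f t) + 0 * L2_sq (\<lambda>t. \<phi> n t * gaussian t - f t)" by simp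
    qed auto
  qed
  then show ?thesis by (simp add: mult_op_def)
qed

text \<open>Evaluate \<open>A (D_hat gaussian)\<close> and \<open>D_hat (A gaussian)\<close> through
  the symbol and cancel the nonzero factor \<open>gaussian (s / 2)\<close>. This gives invariance
  under halving, and substituting 2 * s turns it into doubling.\<close>

lemma symbol_double: "AE s in lborel. symbol s = symbol (2 * s)"
proof -
  let ?c = "complex_of_real (1 / sqrt 2)"
  have "ae_eq (\<lambda>s. symbol s * D_hat gaussian s) (D_hat (A gaussian))"
    using op_eq_mult_symbol[OF L2_D_hat[OF L2_gaussian]] comm_D L2_gaussian
    unfolding commutes_def mult_op_def by (blast intro: ae_eq_trans ae_eq_sym)
  then have "AE s in lborel. symbol s = symbol (s / 2)"
    using D_hat_eq[OF L2_gaussian] D_hat_eq[OF L2_op[OF L2_gaussian]] unfolding ae_eq_def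
  proof eventually_elim
    case (elim s)
    then have "symbol s * (?c * gaussian (s / 2)) = ?c * (symbol (s / 2) * gaussian (s / 2))"
      by (simp only: symbol_gaussian)
    then show ?case using gaussian_nonzero[of "s / 2"] by simp
  qed
  from AE_borel_affine[OF _ _ this, of 2 0] have "AE s in lborel. symbol (2 * s) = symbol s" by simp
  then show ?thesis by eventually_elim simp
qed

end

section \<open>The converse inclusion: multiplication operators in the commutant\<close>

lemma bounded_op_mult_op:
  assumes "Linf h"
  shows "bounded_op (mult_op h)"
proof -
  obtain C where [measurable]: "h \<in> borel_measurable borel" and C: "AE s in lborel. cmod (h s) \<le> C"
    using assms by (auto simp: Linf_def)
  have L2: "L2 (mult_op h f)" if "L2 f" for f
    unfolding mult_op_def by (rule L2_bounded_mult[OF that _ C]) simp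
  \<comment> \<open>The absolute value makes the right-hand side nonnegative, so the inequality
    follows by comparing squares.\<close>
  have bound: "L2_norm (mult_op h f) \<le> \<bar>C\<bar> * L2_norm f" if f: "L2 f" for f
  proof -
    have [measurable]: "f \<in> borel_measurable borel" using f by (rule L2_measurable)
    have "L2_sq (mult_op h f) \<le> L2_sq (\<lambda>t. complex_of_real C * f t)"
    proof (rule L2_sq_mono_AE)
      show "AE t in lborel. cmod (mult_op h f t) \<le> cmod (complex_of_real C * f t)"
        using C by eventually_elim (auto simp: mult_op_def norm_mult intro!: mult_right_mono)
    qed
    also have "\<dots> = ennreal (C\<^sup>2) * L2_sq f" by (subst L2_sq_scale) auto
    finally have "(L2_norm (mult_op h f))\<^sup>2 \<le> (\<bar>C\<bar> * L2_norm f)\<^sup>2"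
      by (simp add: L2_sq_eq_L2_norm f L2 ennreal_mult[symmetric] power_mult_distrib)
    then show ?thesis by (rule power2_le_imp_le) (simp add: L2_norm_def)
  qed
  show ?thesis
    unfolding bounded_op_def
  proof (intro conjI allI impI exI[of _ "\<bar>C\<bar>"] L2 bound)
    show "ae_eq (mult_op h f) (mult_op h g)" if "ae_eq f g" for f g
      using that unfolding ae_eq_def by eventually_elim (simp add: mult_op_def)
    show "ae_eq (mult_op h (\<lambda>t. f t + a * g t)) (\<lambda>t. mult_op h f t + a * mult_op h g t)" for f g a
      by (simp add: ae_eq_def mult_op_def algebra_simps)
  qed
qed

lemma mult_op_commutes_T_hat:
  assumes "Linf h"
  shows "commutes (mult_op h) T_hat"
  unfolding commutes_def
proof (intro allI impI)
  fix f assume f: "L2 f"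
  have "L2 (mult_op h f)" using bounded_op_mult_op[OF assms] f by (simp add: bounded_op_def)
  from T_hat_eq[OF this] T_hat_eq[OF f]
  show "ae_eq (mult_op h (T_hat f)) (T_hat (mult_op h f))"
    unfolding ae_eq_def by eventually_elim (simp add: mult_op_def)
qed

lemma mult_op_commutes_D_hat:
  assumes "Linf h" and h: "AE s in lborel. h s = h (2 * s)"
  shows "commutes (mult_op h) D_hat"
  unfolding commutes_def
proof (intro allI impI)
  fix f assume f: "L2 f"
  have [measurable]: "h \<in> borel_measurable borel" using assms by (simp add: Linf_def)
  have hf: "L2 (mult_op h f)" using bounded_op_mult_op[OF assms(1)] f by (simp add: bounded_op_def)
  have "AE s in lborel. h (s / 2) = h s"
    using AE_borel_affine[OF _ _ h, of "1/2" 0] by simp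
  then show "ae_eq (mult_op h (D_hat f)) (D_hat (mult_op h f))"
    using D_hat_eq[OF f] D_hat_eq[OF hf]
    unfolding ae_eq_def by eventually_elim (simp add: mult_op_def)
qed

text \<open>The set equality is stated as two inclusions, with operators identified when they agree
  a.e. on every L2 function.\<close>

theorem theorem6:
  shows "(\<forall>A. bounded_op A \<and> commutes A D_hat \<and> commutes A T_hat \<longrightarrow>
            (\<exists>h. Linf h \<and> (AE s in lborel. h s = h (2 * s)) \<and>
                 (\<forall>f. L2 f \<longrightarrow> ae_eq (A f) (mult_op h f)))) \<and>
         (\<forall>h. Linf h \<and> (AE s in lborel. h s = h (2 * s)) \<longrightarrow>
            bounded_op (mult_op h) \<and> commutes (mult_op h) D_hat \<and> commutes (mult_op h) T_hat)"
proof (intro conjI allI impI)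
  fix A :: "(real \<Rightarrow> complex) \<Rightarrow> real \<Rightarrow> complex"
  assume A: "bounded_op A \<and> commutes A D_hat \<and> commutes A T_hat"
  then interpret commuting_operator A by unfold_locales auto
  have "Linf symbol" using symbol_bounded by (simp add: Linf_def)
  then show "\<exists>h. Linf h \<and> (AE s in lborel. h s = h (2 * s)) \<and> (\<forall>f. L2 f \<longrightarrow> ae_eq (A f) (mult_op h f))"
    using symbol_double op_eq_mult_symbol by (intro exI[of _ symbol]) simp
qed (auto intro: bounded_op_mult_op mult_op_commutes_T_hat mult_op_commutes_D_hat)

end
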